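(* Let $H_2\in\omega^\omega$ be defined by $H_2(n)=2^{2^{(n^4)}}$. If $\operatorname{add}(\mathcal{N})=\mathfrak{l}'_{H_2}$, then $\mathfrak{ht}=\operatorname{add}(\mathcal{N})$.
   Context: A slalom is a sequence $\varphi=\langle\varphi(n):n<\omega\rangle$ of finite subsets of $\omega$. $\mathcal{S}$ is the set of slaloms with $|\varphi(n)|\leq 2^n$ for all $n$, and $\mathcal{S}^+=\{\varphi\in\mathcal{S}:\lim_{n\to\infty}|\varphi(n)|/2^n=0\}$. For $f\in\omega^\omega$, $f\sqsubseteq\varphi$ means $f(n)\in\varphi(n)$ for all but finitely many $n$. For $h\in\omega^\omega$, $\mathfrak{l}'_h$ is the least cardinality of a set $\Phi\subseteq\mathcal{S}^+$ such that every $f\in\prod_{n<\omega}h(n)$ satisfies $f\sqsubseteq\varphi$ for some $\varphi\in\Phi$. $\operatorname{add}(\mathcal{N})$ is the additivity of the Lebesgue null ideal. Compactifications: for compactifications $\alpha X,\gamma X$ of a Tychonoff space $X$, $\alpha X\leq\gamma X$ means there is a continuous surjection $\gamma X\to\alpha X$ fixing the points of $X$, and $\alpha X\simeq\gamma X$ means $\alpha X\leq\gamma X\leq\alpha X$; $\beta X$ is the Stone–Čech compactification. A metric $d$ on $\omega$ is proper if every $d$-bounded set is finite. For a proper metric $d$ on $\omega$, a bounded function $f:\omega\to\mathbb{R}$ is a Higson function if for every $R>0$ and $\varepsilon>0$ there is a finite $K\subseteq\omega$ such that $|f(x)-f(y)|<\varepsilon$ whenever $x,y\notin K$ and $d(x,y)\leq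 R$; the Higson compactification $\overline{\omega}^d$ is the compactification of $\omega$ determined by the algebra of Higson functions (the smallest compactification to which every Higson function extends continuously). $\mathfrak{ht}$ is the least cardinality of a set $D$ of proper metrics on $\omega$ such that (1) $\{\overline{\omega}^d:d\in D\}$ is well-ordered by $\leq$; (2) there is no $d\in D$ with $\overline{\omega}^d\simeq\beta\omega$; (3) $\beta\omega\simeq\sup\{\overline{\omega}^d:d\in D\}$, supremum with respect to $\leq$ among compactifications of $\omega$; and $\mathfrak{ht}=\mathfrak{c}^+$ if no such $D$ exists. *)

theory Defs
  imports "HOL-Analysis.Analysis"
begin

unbundle cardinal_syntax

section \<open>Least cardinalities\<close>

text \<open>Cardinals are the cardinal well-orders of the BNF cardinal library, compared across types
  by \<open>=o\<close> and \<open>\<le>o\<close>. The least cardinality of a set satisfying \<open>P\<close>; it is unspecified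
  when no set satisfies \<open>P\<close>.\<close>

definition min_card :: "('a set \<Rightarrow> bool) \<Rightarrow> 'a rel" where
  "min_card P = |SOME A. P A \<and> (\<forall>B. P B \<longrightarrow> |A| \<le>o |B| )|"

lemma ex_min_card:
  assumes "P A"
  shows "\<exists>A. P A \<and> (\<forall>B. P B \<longrightarrow> |A| \<le>o |B| )"
proof -
  have "\<exists>r\<in>card_of ` Collect P. \<forall>r'\<in>card_of ` Collect P. r \<le>o r'"
    by (rule exists_minim_Card_order) (use assms in \<open>auto simp: card_of_Card_order\<close>)
  then show ?thesis by auto
qed

definition add_null :: "real set rel" where
  "add_null = min_card (\<lambda>\<A>. \<A> \<subseteq> null_sets lebesgue \<and> \<Union>\<A> \<notin> null_sets lebesgue)"

section \<open>Slaloms\<close>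

definition slaloms :: "(nat \<Rightarrow> nat set) set" where
  "slaloms = {\<phi>. \<forall>n. finite (\<phi> n) \<and> card (\<phi> n) \<le> 2 ^ n}"

definition slaloms_plus :: "(nat \<Rightarrow> nat set) set" where
  "slaloms_plus = {\<phi> \<in> slaloms. (\<lambda>n. real (card (\<phi> n)) / 2 ^ n) \<longlonglongrightarrow> 0}"

definition captured :: "(nat \<Rightarrow> nat) \<Rightarrow> (nat \<Rightarrow> nat set) \<Rightarrow> bool"  (infix \<open>\<sqsubseteq>\<^sub>s\<close> 50) where
  "f \<sqsubseteq>\<^sub>s \<phi> \<longleftrightarrow> (\<forall>\<^sub>\<infinity>n. f n \<in> \<phi> n)"

definition l_prime :: "(nat \<Rightarrow> nat) \<Rightarrow> (nat \<Rightarrow> nat set) rel" where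
  "l_prime h = min_card (\<lambda>\<Phi>. \<Phi> \<subseteq> slaloms_plus \<and>
     (\<forall>f \<in> (\<Pi> n\<in>UNIV. {..<h n}). \<exists>\<phi>\<in>\<Phi>. f \<sqsubseteq>\<^sub>s \<phi>))"

definition H2 :: "nat \<Rightarrow> nat" where
  "H2 n = 2 ^ (2 ^ (n ^ 4))"

section \<open>Compactifications of \<open>\<omega>\<close>\<close>

text \<open>A compactification of the discrete space \<open>\<omega>\<close> is a space together with the embedding of
  \<open>\<omega>\<close> into it.\<close>

type_synonym 'a cpt = "'a topology \<times> (nat \<Rightarrow> 'a)"

definition is_compactification :: "'a cpt \<Rightarrow> bool" where
  "is_compactification c \<longleftrightarrow>
     compact_space (fst c) \<and> Hausdorff_space (fst c) \<and>
     embedding_map (discrete_topology UNIV) (fst c) (snd c) \<and>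
     fst c closure_of range (snd c) = topspace (fst c)"

definition cpt_le :: "'a cpt \<Rightarrow> 'b cpt \<Rightarrow> bool"  (infix \<open>\<preceq>\<close> 50) where
  "a \<preceq> c \<longleftrightarrow> (\<exists>g. continuous_map (fst c) (fst a) g \<and> g ` topspace (fst c) = topspace (fst a) \<and>
                 (\<forall>n. g (snd c n) = snd a n))"

definition cpt_equiv :: "'a cpt \<Rightarrow> 'b cpt \<Rightarrow> bool"  (infix \<open>\<simeq>\<close> 50) where
  "a \<simeq> c \<longleftrightarrow> a \<preceq> c \<and> c \<preceq> a"

text \<open>The compactification determined by a family \<open>F\<close> of bounded functions: the closure of the
  image of \<open>\<omega>\<close> under the evaluation map into \<open>\<real>\<^sup>F\<close>.\<close>

definition eval_emb :: "(nat \<Rightarrow> real) set \<Rightarrow> nat \<Rightarrow> (nat \<Rightarrow> real) \<Rightarrow> real" where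
  "eval_emb F n = (\<lambda>f\<in>F. f n)"

definition cpt_of :: "(nat \<Rightarrow> real) set \<Rightarrow> ((nat \<Rightarrow> real) \<Rightarrow> real) cpt" where
  "cpt_of F =
     (subtopology (product_topology (\<lambda>_. euclideanreal) F)
        (product_topology (\<lambda>_. euclideanreal) F closure_of range (eval_emb F)), eval_emb F)"

definition beta_omega :: "((nat \<Rightarrow> real) \<Rightarrow> real) cpt" where
  "beta_omega = cpt_of {f. bounded (range f)}"

definition extends_to :: "(nat \<Rightarrow> real) \<Rightarrow> 'a cpt \<Rightarrow> bool" where
  "extends_to f c \<longleftrightarrow> (\<exists>g. continuous_map (fst c) euclideanreal g \<and> (\<forall>n. g (snd c n) = f n))"

text \<open>The next three lemmas show that \<open>cpt_of F\<close> is the \<open>\<preceq>\<close>-smallest compactification to which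
  every function in \<open>F\<close> extends continuously.\<close>

lemma cpt_of_is_compactification:
  assumes bdd: "\<And>f. f \<in> F \<Longrightarrow> bounded (range f)"
    and ind: "\<And>n. (\<lambda>k. if k = n then 1 else 0) \<in> F"
  shows "is_compactification (cpt_of F)"
proof -
  let ?P = "product_topology (\<lambda>_. euclideanreal) F"
  let ?T = "subtopology ?P (?P closure_of range (eval_emb F))"
  have rng: "range (eval_emb F) \<subseteq> topspace ?P"
    by (auto simp: eval_emb_def)
  have haus: "Hausdorff_space ?P"
    by (simp add: Hausdorff_space_product_topology)
  have "\<forall>f\<in>F. \<exists>B. \<forall>n. \<bar>f n\<bar> \<le> B"
    using bdd by (auto simp: bounded_iff)
  then obtain B where B: "\<And>f n. f \<in> F \<Longrightarrow> \<bar>f n\<bar> \<le> B f"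
    by metis
  have cK: "compactin ?P (PiE F (\<lambda>f. {- B f..B f}))"
    by (subst compactin_PiE) auto
  have "f n \<in> {- B f..B f}" if "f \<in> F" for f n
    using B[OF that, of n] by (auto simp: abs_le_iff)
  then have "range (eval_emb F) \<subseteq> PiE F (\<lambda>f. {- B f..B f})"
    by (auto simp: eval_emb_def)
  then have "?P closure_of range (eval_emb F) \<subseteq> PiE F (\<lambda>f. {- B f..B f})"
    using compactin_imp_closedin[OF haus cK] by (rule closure_of_minimal)
  then have "compactin ?P (?P closure_of range (eval_emb F))"
    by (rule closed_compactin[OF cK]) simp
  then have comp: "compact_space ?T"
    by (rule compact_space_subtopology)
  have dense: "?T closure_of range (eval_emb F) = topspace ?T"
  proof -
    have "?P closure_of range (eval_emb F) \<inter> range (eval_emb F) = range (eval_emb F)"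
      using closure_of_subset[OF rng] by (rule Int_absorb1)
    moreover have "topspace ?P \<inter> ?P closure_of range (eval_emb F) = ?P closure_of range (eval_emb F)"
      by (rule Int_absorb1) (rule closure_of_subset_topspace)
    ultimately show ?thesis
      unfolding closure_of_subtopology topspace_subtopology by simp
  qed
  have emb: "embedding_map (discrete_topology UNIV) ?P (eval_emb F)"
    unfolding embedding_map_def
  proof (rule bijective_open_imp_homeomorphic_map)
    show "continuous_map (discrete_topology UNIV)
            (subtopology ?P (eval_emb F ` topspace (discrete_topology UNIV))) (eval_emb F)"
      using rng by auto
    show "open_map (discrete_topology UNIV)
            (subtopology ?P (eval_emb F ` topspace (discrete_topology UNIV))) (eval_emb F)"
      unfolding open_map_def
    proof clarsimp
      fix U :: "nat set"
      have "openin (subtopology ?P (range (eval_emb F))) {eval_emb F n}" for n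
      proof -
        let ?i = "\<lambda>k. if k = n then 1 else 0 :: real"
        let ?V = "{x \<in> topspace ?P. x ?i \<in> {1/2<..}}"
        have V: "openin ?P ?V"
          by (rule openin_continuous_map_preimage[OF continuous_map_product_projection[OF ind]])
             simp
        have *: "eval_emb F m ?i = (if m = n then 1 else 0)" for m
          using ind[of n] by (simp add: eval_emb_def)
        have "{eval_emb F n} = ?V \<inter> range (eval_emb F)"
        proof
          show "{eval_emb F n} \<subseteq> ?V \<inter> range (eval_emb F)"
            using rng *[of n] by auto
          show "?V \<inter> range (eval_emb F) \<subseteq> {eval_emb F n}"
          proof
            fix x assume "x \<in> ?V \<inter> range (eval_emb F)"
            then obtain m where "x = eval_emb F m" "eval_emb F m ?i > 1/2" by auto
            with *[of m] show "x \<in> {eval_emb F n}" by (auto split: if_splits)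
          qed
        qed
        with V show ?thesis
          by (auto simp: openin_subtopology)
      qed
      then have "openin (subtopology ?P (range (eval_emb F))) (\<Union>n\<in>U. {eval_emb F n})"
        by (intro openin_Union) auto
      then show "openin (subtopology ?P (range (eval_emb F))) (eval_emb F ` U)"
        by (simp add: UNION_singleton_eq_range)
    qed
    show "eval_emb F ` topspace (discrete_topology UNIV) =
            topspace (subtopology ?P (eval_emb F ` topspace (discrete_topology UNIV)))"
      using rng by auto
    show "inj_on (eval_emb F) (topspace (discrete_topology UNIV))"
    proof (rule inj_onI)
      fix m n assume "eval_emb F m = eval_emb F n"
      then have "eval_emb F m (\<lambda>k. if k = n then 1 else 0) = eval_emb F n (\<lambda>k. if k = n then 1 else 0)"
        by simp
      then show "m = n"
        using ind[of n] by (simp add: eval_emb_def split: if_splits)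
    qed
  qed
  have "embedding_map (discrete_topology UNIV) ?T (eval_emb F)"
    using emb closure_of_subset[OF rng] by (auto simp: embedding_map_in_subtopology)
  then show ?thesis
    using comp dense haus
    by (simp add: is_compactification_def cpt_of_def Hausdorff_space_subtopology)
qed

lemma extends_to_cpt_of:
  assumes "f \<in> F"
  shows "extends_to f (cpt_of F)"
proof -
  have "continuous_map (fst (cpt_of F)) euclideanreal (\<lambda>x. x f)"
    using assms unfolding cpt_of_def
    by (auto intro: continuous_map_from_subtopology continuous_map_product_projection)
  then show ?thesis
    using assms by (auto simp: extends_to_def cpt_of_def eval_emb_def)
qed

lemma cpt_of_le:
  assumes c: "is_compactification c" and ext: "\<And>f. f \<in> F \<Longrightarrow> extends_to f c"
  shows "cpt_of F \<preceq> c"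
proof -
  let ?P = "product_topology (\<lambda>_. euclideanreal) F"
  let ?C = "?P closure_of range (eval_emb F)"
  obtain T e where ce: "c = (T, e)" by (cases c)
  from ext obtain G where
    G: "\<And>f. f \<in> F \<Longrightarrow> continuous_map T euclideanreal (G f)" "\<And>f n. f \<in> F \<Longrightarrow> G f (e n) = f n"
    unfolding extends_to_def ce by simp metis
  define \<Theta> where "\<Theta> p = (\<lambda>f\<in>F. G f p)" for p
  have cont: "continuous_map T ?P \<Theta>"
    unfolding continuous_map_componentwise using G(1) by (auto simp: \<Theta>_def)
  have fixpt: "\<Theta> (e n) = eval_emb F n" for n
    using G(2) by (auto simp: \<Theta>_def eval_emb_def)
  have dense: "T closure_of range e = topspace T" and comp: "compact_space T"
    using c by (auto simp: is_compactification_def ce)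
  have "range e \<subseteq> topspace T"
    using c by (auto simp: is_compactification_def ce embedding_map_def homeomorphic_map_def
        quotient_map_def)
  have im: "\<Theta> ` range e = range (eval_emb F)"
    using fixpt by (auto simp: image_image)
  have sub: "\<Theta> ` topspace T \<subseteq> ?C"
    using continuous_map_image_closure_subset[OF cont, of "range e"] im dense by simp
  have "compactin ?P (\<Theta> ` topspace T)"
    using comp cont image_compactin unfolding compact_space_def by blast
  then have "closedin ?P (\<Theta> ` topspace T)"
    by (intro compactin_imp_closedin) (auto simp: Hausdorff_space_product_topology)
  moreover have "range (eval_emb F) \<subseteq> \<Theta> ` topspace T"
    using im \<open>range e \<subseteq> topspace T\<close> by blast
  ultimately have "?C \<subseteq> \<Theta> ` topspace T"
    by (intro closure_of_minimal)
  with sub have surj: "\<Theta> ` topspace T = ?C" by blast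
  then have "\<Theta> ` topspace T = topspace (subtopology ?P ?C)"
    using closure_of_subset_topspace[of ?P "range (eval_emb F)"] by auto
  moreover have "continuous_map T (subtopology ?P ?C) \<Theta>"
    using cont surj by (auto simp: continuous_map_in_subtopology)
  ultimately show ?thesis
    using fixpt unfolding cpt_le_def cpt_of_def ce by auto
qed

text \<open>Every compactification of \<open>\<omega>\<close>, on whatever type, is equivalent to one on the type of
  \<open>cpt_of\<close>. Hence quantifying over the compactifications on that single type loses nothing.\<close>

lemma compactification_equiv_cpt_of:
  assumes c: "is_compactification c"
  shows "cpt_of {f. extends_to f c} \<simeq> c"
proof -
  let ?F = "{f. extends_to f c}"
  obtain T e where ce: "c = (T, e)" by (cases c)
  let ?S = "fst (cpt_of ?F)"
  have le: "cpt_of ?F \<preceq> c"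
    using c by (rule cpt_of_le) simp
  then obtain g where g: "continuous_map T ?S g" "g ` topspace T = topspace ?S"
      "\<And>n. g (e n) = eval_emb ?F n"
    unfolding cpt_le_def ce by (auto simp: cpt_of_def)
  have comp: "compact_space T" and haus: "Hausdorff_space T"
    and dense: "T closure_of range e = topspace T"
    using c by (auto simp: is_compactification_def ce)
  have rng: "range e \<subseteq> topspace T"
    using c by (auto simp: is_compactification_def ce embedding_map_def homeomorphic_map_def
        quotient_map_def)
  have haus': "Hausdorff_space ?S"
    by (simp add: cpt_of_def Hausdorff_space_subtopology Hausdorff_space_product_topology)
  have proj: "g p f = u p" if u: "continuous_map T euclideanreal u" "\<And>n. u (e n) = f n"
      and p: "p \<in> topspace T" for u f p
  proof -
    have f: "f \<in> ?F" using u by (auto simp: extends_to_def ce)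
    have 1: "continuous_map T euclideanreal (\<lambda>p. g p f)"
    proof -
      have "continuous_map ?S euclideanreal (\<lambda>x. x f)"
        using f unfolding cpt_of_def
        by (auto intro: continuous_map_from_subtopology continuous_map_product_projection)
      from continuous_map_compose[OF g(1) this] show ?thesis by (simp add: o_def)
    qed
    have "closedin T {p \<in> topspace T. g p f = u p}"
      using 1 u(1) by (intro closedin_continuous_maps_eq[of euclideanreal]) auto
    moreover have "range e \<subseteq> {p \<in> topspace T. g p f = u p}"
      using rng f u(2) g(3) by (auto simp: eval_emb_def)
    ultimately show ?thesis
      using dense p closure_of_minimal by fast
  qed
  have inj: "inj_on g (topspace T)"
  proof (rule inj_onI, rule ccontr)
    fix p q assume pq: "p \<in> topspace T" "q \<in> topspace T" "g p = g q" "p \<noteq> q"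
    have cr: "completely_regular_space T"
      using comp haus compact_Hausdorff_or_regular_imp_normal_space
        normal_imp_completely_regular_space by blast
    have "closedin T {q}"
      using haus pq(2) by (rule closedin_Hausdorff_singleton)
    then obtain u where u: "continuous_map T euclideanreal u" "u p = 0" "u q = 1"
      using cr[unfolded completely_regular_space_alt, rule_format, of "{q}" p] pq by auto
    have "g p (\<lambda>n. u (e n)) = u p" "g q (\<lambda>n. u (e n)) = u q"
      by (rule proj[OF u(1) refl pq(1)], rule proj[OF u(1) refl pq(2)])
    with u pq show False by simp
  qed
  have "homeomorphic_map T ?S g"
    by (rule continuous_imp_homeomorphic_map[OF g(1) comp haus' g(2) inj])
  then obtain k where k: "homeomorphic_maps T ?S g k"
    unfolding homeomorphic_map_maps by (rule exE)
  have "k ` topspace ?S = topspace T"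
    using k by (intro homeomorphic_imp_surjective_map) (simp add: homeomorphic_maps_map)
  moreover have "continuous_map ?S T k" "k (eval_emb ?F n) = e n" for n
    using k rng g(3)[of n, symmetric] by (auto simp: homeomorphic_maps_def)
  ultimately have "c \<preceq> cpt_of ?F"
    unfolding cpt_le_def ce by (auto simp: cpt_of_def)
  with le show ?thesis by (simp add: cpt_equiv_def)
qed

definition is_cpt_sup ::
    "((nat \<Rightarrow> real) \<Rightarrow> real) cpt set \<Rightarrow> ((nat \<Rightarrow> real) \<Rightarrow> real) cpt \<Rightarrow> bool" where
  "is_cpt_sup C s \<longleftrightarrow> is_compactification s \<and> (\<forall>c\<in>C. c \<preceq> s) \<and>
     (\<forall>t :: ((nat \<Rightarrow> real) \<Rightarrow> real) cpt.
        is_compactification t \<and> (\<forall>c\<in>C. c \<preceq> t) \<longrightarrow> s \<preceq> t)"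

section \<open>Higson compactifications and the cardinal \<open>\<hh>\<tt>\<close>\<close>

definition proper_metric :: "(nat \<Rightarrow> nat \<Rightarrow> real) \<Rightarrow> bool" where
  "proper_metric d \<longleftrightarrow> Metric_space UNIV d \<and> (\<forall>A. Metric_space.mbounded UNIV d A \<longrightarrow> finite A)"

definition higson_function :: "(nat \<Rightarrow> nat \<Rightarrow> real) \<Rightarrow> (nat \<Rightarrow> real) \<Rightarrow> bool" where
  "higson_function d f \<longleftrightarrow> bounded (range f) \<and>
     (\<forall>R>0. \<forall>\<epsilon>>0. \<exists>K. finite K \<and>
        (\<forall>x y. x \<notin> K \<and> y \<notin> K \<and> d x y \<le> R \<longrightarrow> \<bar>f x - f y\<bar> < \<epsilon>))"

definition higson :: "(nat \<Rightarrow> nat \<Rightarrow> real) \<Rightarrow> ((nat \<Rightarrow> real) \<Rightarrow> real) cpt" where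
  "higson d = cpt_of {f. higson_function d f}"

lemma higson_is_compactification: "is_compactification (higson d)"
  unfolding higson_def
proof (rule cpt_of_is_compactification)
  show "(\<lambda>k. if k = n then 1 else 0) \<in> {f. higson_function d f}" for n :: nat
  proof -
    have "bounded (range (\<lambda>k. if k = n then 1 else 0 :: real))"
      by (auto simp: bounded_iff intro!: exI[of _ 1])
    then show ?thesis
      by (auto simp: higson_function_def intro!: exI[of _ "{n}"])
  qed
qed (simp add: higson_function_def)

lemma beta_omega_is_compactification: "is_compactification beta_omega"
  unfolding beta_omega_def
proof (rule cpt_of_is_compactification)
  show "(\<lambda>k. if k = n then 1 else 0) \<in> {f :: nat \<Rightarrow> real. bounded (range f)}" for n :: nat
  proof -
    have "bounded (range (\<lambda>k. if k = n then 1 else 0 :: real))"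
      by (auto simp: bounded_iff intro!: exI[of _ 1])
    then show ?thesis
      by simp
  qed
qed simp

lemma extends_to_mono:
  assumes "extends_to f a" "a \<preceq> c"
  shows "extends_to f c"
proof -
  obtain u g where "continuous_map (fst a) euclideanreal u" "\<And>n. u (snd a n) = f n"
    "continuous_map (fst c) (fst a) g" "\<And>n. g (snd c n) = snd a n"
    using assms unfolding extends_to_def cpt_le_def by blast
  then have "continuous_map (fst c) euclideanreal (u \<circ> g) \<and> (\<forall>n. (u \<circ> g) (snd c n) = f n)"
    using continuous_map_compose by force
  then show ?thesis unfolding extends_to_def by blast
qed

lemma extends_to_higson_iff: "extends_to f (higson d) \<longleftrightarrow> higson_function d f"
proof
  assume "higson_function d f"
  then show "extends_to f (higson d)"
    unfolding higson_def by (intro extends_to_cpt_of) simp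
next
  assume "extends_to f (higson d)"
  let ?F = "{f. higson_function d f}"
  let ?P = "product_topology (\<lambda>_. euclideanreal) ?F"
  obtain T e where Te: "higson d = (T, e)" by (cases "higson d")
  have e: "e = eval_emb ?F" and T: "T = subtopology ?P (?P closure_of range e)"
    using Te by (auto simp: higson_def cpt_of_def)
  have comp: "compact_space T"
    using higson_is_compactification[of d] by (simp add: Te is_compactification_def)
  have rng: "e n \<in> topspace T" for n
    using higson_is_compactification[of d]
    by (auto simp: Te is_compactification_def embedding_map_def homeomorphic_map_def
        quotient_map_def)
  obtain g where g: "continuous_map T euclideanreal g" "\<And>n. g (e n) = f n"
    using \<open>extends_to f (higson d)\<close> by (auto simp: extends_to_def Te)
  have "compactin euclideanreal (g ` topspace T)"
    using comp g(1) image_compactin unfolding compact_space_def by blast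
  then have "bounded (g ` topspace T)"
    by (simp add: compact_imp_bounded)
  moreover have "range f \<subseteq> g ` topspace T"
    using g(2) rng by (metis image_eqI image_subsetI)
  ultimately have bdd: "bounded (range f)"
    using bounded_subset by blast
  have "\<exists>K. finite K \<and> (\<forall>x y. x \<notin> K \<and> y \<notin> K \<and> d x y \<le> R \<longrightarrow> \<bar>f x - f y\<bar> < \<epsilon>)"
    if "R > 0" "\<epsilon> > 0" for R \<epsilon>
  proof (rule ccontr)
    assume neg: "\<not> ?thesis"
    define A where "A k = {(e x, e y) | x y. x > k \<and> y > k \<and> d x y \<le> R \<and> \<bar>f x - f y\<bar> \<ge> \<epsilon>}"
      for k :: nat
    let ?T2 = "prod_topology T T"
    have Asub: "A k \<subseteq> topspace ?T2" for k
      using rng by (auto simp: A_def)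
    have "A k \<noteq> {}" for k
    proof -
      have "\<exists>x y. x \<notin> {..k} \<and> y \<notin> {..k} \<and> d x y \<le> R \<and> \<not> \<bar>f x - f y\<bar> < \<epsilon>"
        using neg finite_atMost by blast
      then show ?thesis by (auto simp: A_def not_less not_le)
    qed
    then have ne: "?T2 closure_of A k \<noteq> {}" for k
      using closure_of_subset[OF Asub[of k]] by blast
    have "compact_space ?T2"
      using comp by (simp add: compact_space_prod_topology)
    moreover have "decseq (\<lambda>k. ?T2 closure_of A k)"
      by (intro antimonoI closure_of_mono) (unfold A_def, blast intro: le_less_trans)
    ultimately have "(\<Inter>k. ?T2 closure_of A k) \<noteq> {}"
      using ne by (intro compact_space_imp_nest) auto
    then obtain p q where pq: "\<And>k. (p, q) \<in> ?T2 closure_of A k"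
      by auto
    then have pqT: "p \<in> topspace T" "q \<in> topspace T"
      using closure_of_subset_topspace[of ?T2 "A 0"] by (auto dest: subsetD)
    have lim: "\<bar>u p - u q\<bar> \<in> S"
      if u: "continuous_map T euclideanreal u" and S: "closed S"
        and AS: "\<And>x y. \<lbrakk>x > k; y > k; d x y \<le> R; \<bar>f x - f y\<bar> \<ge> \<epsilon>\<rbrakk> \<Longrightarrow> \<bar>u (e x) - u (e y)\<bar> \<in> S"
      for u S k
    proof -
      have "continuous_map ?T2 euclideanreal (\<lambda>z. \<bar>(u \<circ> fst) z - (u \<circ> snd) z\<bar>)"
        by (intro continuous_map_real_abs continuous_map_diff continuous_map_compose[OF _ u]
            continuous_map_fst continuous_map_snd)
      then have "closedin ?T2 {z \<in> topspace ?T2. \<bar>(u \<circ> fst) z - (u \<circ> snd) z\<bar> \<in> S}"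
        using S closedin_continuous_map_preimage by fastforce
      moreover have "A k \<subseteq> {z \<in> topspace ?T2. \<bar>(u \<circ> fst) z - (u \<circ> snd) z\<bar> \<in> S}"
      proof
        fix z assume z: "z \<in> A k"
        then obtain x y where
          "z = (e x, e y)" "x > k" "y > k" "d x y \<le> R" "\<bar>f x - f y\<bar> \<ge> \<epsilon>"
          unfolding A_def by blast
        then show "z \<in> {z \<in> topspace ?T2. \<bar>(u \<circ> fst) z - (u \<circ> snd) z\<bar> \<in> S}"
          using z AS[of x y] Asub[of k] by auto
      qed
      ultimately show ?thesis
        using pq[of k] closure_of_minimal by fastforce
    qed
    have "\<bar>g p - g q\<bar> \<in> {\<epsilon>..}"
      by (rule lim[where k = 0]) (use g in auto)
    moreover have "p h = q h" for h
    proof (cases "higson_function d h")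
      case True
      have proj: "continuous_map T euclideanreal (\<lambda>x. x h)"
        unfolding T using True
        by (auto intro!: continuous_map_from_subtopology continuous_map_product_projection)
      have eh: "e n h = h n" for n
        using True by (simp add: e eval_emb_def)
      have "\<bar>p h - q h\<bar> \<le> \<delta>" if "\<delta> > 0" for \<delta>
      proof -
        obtain K where K: "finite K"
          "\<And>x y. x \<notin> K \<Longrightarrow> y \<notin> K \<Longrightarrow> d x y \<le> R \<Longrightarrow> \<bar>h x - h y\<bar> < \<delta>"
          using True \<open>R > 0\<close> \<open>\<delta> > 0\<close> unfolding higson_function_def by metis
        obtain k where k: "\<forall>x\<in>K. x \<le> k"
          using K(1) unfolding finite_nat_set_iff_bounded_le by (rule exE)
        have hA: "\<bar>e x h - e y h\<bar> \<le> \<delta>" if "x > k" "y > k" "d x y \<le> R" for x y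
        proof -
          have "x \<notin> K" "y \<notin> K"
            using k that(1,2) leD by auto
          then show ?thesis
            using K(2)[of x y] that(3) by (simp add: eh)
        qed
        have "\<bar>p h - q h\<bar> \<in> {..\<delta>}"
          by (rule lim[where k = k and u = "\<lambda>x. x h"]) (use proj hA in auto)
        then show ?thesis by simp
      qed
      then show ?thesis
        by (metis abs_le_zero_iff dense_ge right_minus_eq)
    next
      case False
      then show ?thesis
        using pqT unfolding T by (auto simp: PiE_def extensional_def)
    qed
    then have "p = q" by blast
    ultimately show False
      using \<open>\<epsilon> > 0\<close> by simp
  qed
  with bdd show "higson_function d f"
    unfolding higson_function_def by blast
qed

text \<open>Compactifications are identified up to \<open>\<simeq>\<close>. On Higson compactifications this is literal
  equality, so \<open>well_order_on\<close> applies to \<open>higson ` D\<close> without passing to \<open>\<simeq>\<close>-classes.\<close>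

lemma higson_equiv_iff: "higson d \<simeq> higson d' \<longleftrightarrow> higson d = higson d'"
proof
  assume "higson d \<simeq> higson d'"
  then have "extends_to f (higson d) \<longleftrightarrow> extends_to f (higson d')" for f
    using extends_to_mono unfolding cpt_equiv_def by blast
  then have "{f. higson_function d f} = {f. higson_function d' f}"
    by (simp add: extends_to_higson_iff)
  then show "higson d = higson d'"
    by (simp add: higson_def)
next
  assume "higson d = higson d'"
  moreover have "higson d' \<preceq> higson d'"
    unfolding cpt_le_def by (intro exI[of _ id]) auto
  ultimately show "higson d \<simeq> higson d'"
    by (simp add: cpt_equiv_def)
qed

definition higson_chain :: "(nat \<Rightarrow> nat \<Rightarrow> real) set \<Rightarrow> bool" where
  "higson_chain D \<longleftrightarrow>
     (\<forall>d\<in>D. proper_metric d) \<and>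
     well_order_on (higson ` D) {(a, b). a \<in> higson ` D \<and> b \<in> higson ` D \<and> a \<preceq> b} \<and>
     \<not> (\<exists>d\<in>D. higson d \<simeq> beta_omega) \<and>
     (\<exists>s. is_cpt_sup (higson ` D) s \<and> beta_omega \<simeq> s)"

text \<open>The summands \<open>czero\<close> only bring the two cases to a common type. The well-orders here are
  compared up to \<open>=o\<close>, and the second case is the successor of the continuum.\<close>

definition ht :: "((nat \<Rightarrow> nat \<Rightarrow> real) + real set) rel" where
  "ht = (if \<exists>D. higson_chain D
         then min_card higson_chain +c (czero :: real set rel)
         else (czero :: (nat \<Rightarrow> nat \<Rightarrow> real) rel) +c cardSuc |UNIV :: real set| )"

end

theory Submission
  imports Defs "HOL-Library.Discrete_Functions"
begin

text \<open>Since Higson compactifications from a chain have nested function algebras, a chain has supremum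
  \<open>\<beta>\<omega>\<close> iff the indicator of every \<open>A \<subseteq> \<omega>\<close> is a Higson function for one of its metrics.

  Lower bound. A metric whose compactification is not \<open>\<beta>\<omega>\<close> has infinitely many disjoint pairs
  at bounded distance. By Bartoszynski's theorem, fewer than \<open>add(\<N>)\<close> such sequences of pairs are
  captured by one slalom, and then one set \<open>A\<close> splits infinitely many pairs of each of them.

  Upper bound. A slalom \<open>\<phi>\<close> of sets of naturals partitions the level \<open>[2 ^ n, 2 ^ (n + 1))\<close> into
  atoms; the metric \<open>d\<close> puts distinct points of one atom at distance \<open>1\<close> and all others at distance growing
  with \<open>n\<close>. If \<open>|\<phi> n| < n\<close>, then some atom has two points and \<open>d\<close> does not give \<open>\<beta>\<omega>\<close>, while the sets captured
  by \<open>\<phi>\<close> have Higson indicators. A covering family for \<open>H2\<close> has the width \<open>2 ^ n\<close>, which is too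
  large, but a second application of the family to the indices of the right guesses narrows it to
  about \<open>sqrt n\<close>. Narrow slaloms are \<open>add(\<N>)\<close>-directed, again by Bartoszynski's theorem, so that the
  \<open>add(\<N>)\<close> many covering slaloms can be replaced by an increasing sequence.\<close>

section \<open>Independent open sets of reals\<close>

text \<open>The union of the dyadic intervals of length \<open>1 / 2 ^ l\<close> with index in
  \<open>J\<close>. With the floor, Boolean operations on such sets become operations on index
  sets.\<close>

definition dyadic :: "nat \<Rightarrow> int set \<Rightarrow> real set" where
  "dyadic l J = {t. \<lfloor>2 ^ l * t\<rfloor> \<in> J}"

lemma dyadic_singleton: "dyadic l {j} = {of_int j / 2 ^ l ..< (of_int j + 1) / 2 ^ l}"
  by (auto simp: dyadic_def floor_eq_iff field_simps)

lemma measure_dyadic: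
  assumes "finite J"
  shows "dyadic l J \<in> lmeasurable" "measure lebesgue (dyadic l J) = card J / 2 ^ l"
proof -
  have "dyadic l J \<in> lmeasurable \<and> measure lebesgue (dyadic l J) = card J / 2 ^ l"
    using assms
  proof (induction J)
    case empty
    then show ?case by (simp add: dyadic_def)
  next
    case (insert j J)
    have eq: "dyadic l (insert j J) = dyadic l {j} \<union> dyadic l J"
      by (auto simp: dyadic_def)
    have j: "dyadic l {j} \<in> lmeasurable" "measure lebesgue (dyadic l {j}) = 1 / 2 ^ l"
      unfolding dyadic_singleton
      by (rule bounded_set_imp_lmeasurable)
        (simp_all add: divide_right_mono flip: diff_divide_distrib)
    have "dyadic l {j} \<inter> dyadic l J = {}"
      using insert.hyps by (auto simp: dyadic_def)
    then show ?case
      using insert j unfolding eq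
      by (simp add: measure_Un3 fmeasurable.Un add_divide_distrib)
  qed
  then show "dyadic l J \<in> lmeasurable" "measure lebesgue (dyadic l J) = card J / 2 ^ l"
    by auto
qed

lemma dyadic_refine: "dyadic l J = dyadic (l + n) {i. i div 2 ^ n \<in> J}"
proof -
  have "\<lfloor>2 ^ l * t\<rfloor> = \<lfloor>2 ^ (l + n) * t\<rfloor> div 2 ^ n" for t :: real
    using floor_divide_real_eq_div[of "2 ^ n" "2 ^ (l + n) * t"] by (simp add: power_add)
  then show ?thesis by (simp add: dyadic_def)
qed

text \<open>An index of the finer level is a coarse index together with a block of new
  digits.\<close>

lemma card_div_mod:
  fixes q :: int
  assumes "finite J" "q > 0" "R \<subseteq> {0..<q}"
  shows "finite {i. i div q \<in> J \<and> i mod q \<in> R}"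
    "card {i. i div q \<in> J \<and> i mod q \<in> R} = card J * card R"
proof -
  have bij: "bij_betw (\<lambda>i. (i div q, i mod q)) {i. i div q \<in> J \<and> i mod q \<in> R} (J \<times> R)"
    by (rule bij_betwI[where g = "\<lambda>(j, r). j * q + r"])
      (use assms(3) in \<open>auto simp: div_mult_self3 subset_iff\<close>)
  have "finite (J \<times> R)"
    using assms finite_subset by auto
  then show "finite {i. i div q \<in> J \<and> i mod q \<in> R}"
    "card {i. i div q \<in> J \<and> i mod q \<in> R} = card J * card R"
    using bij_betw_finite[OF bij] bij_betw_same_card[OF bij] by (simp_all add: card_cartesian_product)
qed

text \<open>Consecutive blocks of binary digits are independent: block \<open>i\<close> has
  \<open>a i\<close> digits, and \<open>B i\<close> demands that all of them vanish, an event of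
  probability \<open>1 / 2 ^ a i\<close>.\<close>

lemma ex_independent_sets:
  fixes a :: "nat \<Rightarrow> nat"
  shows "\<exists>B :: nat \<Rightarrow> real set. (\<forall>T m. {0..<1} - (\<Union>i\<in>T \<inter> {..<m}. B i) \<in> lmeasurable \<and>
    measure lebesgue ({0..<1} - (\<Union>i\<in>T \<inter> {..<m}. B i)) = (\<Prod>i\<in>T \<inter> {..<m}. 1 - 1 / 2 ^ a i))"
proof -
  define L where "L m = (\<Sum>i<m. a i)" for m
  define B where "B i = dyadic (L (Suc i)) {j. j mod 2 ^ a i = 0}" for i
  have *: "\<exists>J. finite J \<and> {0..<1} - (\<Union>i\<in>T \<inter> {..<m}. B i) = dyadic (L m) J \<and>
     card J / 2 ^ L m = (\<Prod>i\<in>T \<inter> {..<m}. 1 - 1 / 2 ^ a i)" for T m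
  proof (induction m)
    case 0
    show ?case
      by (rule exI[of _ "{0}"]) (auto simp: L_def dyadic_def floor_eq_iff)
  next
    case (Suc m)
    then obtain J where J: "finite J" "{0..<1} - (\<Union>i\<in>T \<inter> {..<m}. B i) = dyadic (L m) J"
      "card J / 2 ^ L m = (\<Prod>i\<in>T \<inter> {..<m}. 1 - 1 / 2 ^ a i)"
      by blast
    \<comment> \<open>The values that block \<open>m\<close> of the digits may take:
      \<open>0\<close> is forbidden exactly if \<open>m \<in> T\<close>.\<close>
    define R :: "int set" where "R = (if m \<in> T then {1..<2 ^ a m} else {0..<2 ^ a m})"
    define J' where "J' = {i. i div 2 ^ a m \<in> J \<and> i mod 2 ^ a m \<in> R}"
    have "R \<subseteq> {0..<2 ^ a m}"
      by (auto simp: R_def)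
    note J' = card_div_mod[OF J(1) _ this, folded J'_def, simplified]
    have L: "L (Suc m) = L m + a m"
      by (simp add: L_def)
    have ins: "T \<inter> {..<Suc m} = (if m \<in> T then insert m (T \<inter> {..<m}) else T \<inter> {..<m})"
      by (auto simp: less_Suc_eq)
    have pos: "0 \<le> i mod 2 ^ a m" for i :: int
      by simp
    have nz: "1 \<le> i mod 2 ^ a m \<longleftrightarrow> i mod 2 ^ a m \<noteq> 0" for i :: int
      using pos[of i] by linarith
    have "{0..<1} - (\<Union>i\<in>T \<inter> {..<Suc m}. B i) = dyadic (L (Suc m)) J'"
    proof (cases "m \<in> T")
      case True
      then have "{0..<1} - (\<Union>i\<in>T \<inter> {..<Suc m}. B i) = dyadic (L m) J - B m"
        unfolding J(2)[symmetric] ins by auto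
      then show ?thesis
        using True unfolding dyadic_refine[of "L m" J "a m"] B_def
        by (auto simp: L dyadic_def J'_def R_def nz)
    next
      case False
      then have "{0..<1} - (\<Union>i\<in>T \<inter> {..<Suc m}. B i) = dyadic (L m) J"
        unfolding J(2)[symmetric] ins by auto
      then show ?thesis
        using False unfolding dyadic_refine[of "L m" J "a m"]
        by (auto simp: L dyadic_def J'_def R_def)
    qed
    moreover have "card J' / 2 ^ L (Suc m) = (\<Prod>i\<in>T \<inter> {..<Suc m}. 1 - 1 / 2 ^ a i)"
    proof -
      have "real (card R) / 2 ^ a m = (if m \<in> T then 1 - 1 / 2 ^ a m else 1)"
        by (simp add: R_def of_nat_diff diff_divide_distrib nat_diff_distrib nat_power_eq)
      moreover have "card J' / 2 ^ L (Suc m) = (card J / 2 ^ L m) * (card R / 2 ^ a m)"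
        by (simp add: J' L power_add)
      ultimately show ?thesis
        unfolding J(3) ins by auto
    qed
    ultimately show ?case
      using J'(1) by blast
  qed
  show ?thesis
    by (rule exI[of _ B], intro allI) (use *[of _] measure_dyadic in metis)
qed

text \<open>Passing to open supersets costs at most a factor 2 in measure. It only shrinks the
  complements, so the exact product becomes an upper bound.\<close>

lemma ex_open_independent_sets:
  fixes a :: "nat \<Rightarrow> nat"
  shows "\<exists>G :: nat \<Rightarrow> real set. (\<forall>i. open (G i) \<and> G i \<in> lmeasurable \<and> measure lebesgue (G i) \<le> 2 / 2 ^ a i) \<and>
    (\<forall>T. finite T \<longrightarrow> measure lebesgue ({0..<1} - (\<Union>i\<in>T. G i)) \<le> (\<Prod>i\<in>T. 1 - 1 / 2 ^ a i))"
proof -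
  obtain B :: "nat \<Rightarrow> real set" where
    B: "\<And>T m. {0..<1} - (\<Union>i\<in>T \<inter> {..<m}. B i) \<in> lmeasurable"
    "\<And>T m. measure lebesgue ({0..<1} - (\<Union>i\<in>T \<inter> {..<m}. B i)) = (\<Prod>i\<in>T \<inter> {..<m}. 1 - 1 / 2 ^ a i)"
    using ex_independent_sets[of a] by metis
  have I: "({0..<1} :: real set) \<in> lmeasurable"
    by (rule bounded_set_imp_lmeasurable) auto
  have fin: "{0..<1} - (\<Union>i\<in>T. B i) \<in> lmeasurable"
    "measure lebesgue ({0..<1} - (\<Union>i\<in>T. B i)) = (\<Prod>i\<in>T. 1 - 1 / 2 ^ a i)" if T: "finite T" for T
  proof -
    obtain m where "T \<subseteq> {..<m}"
      using finite_nat_bounded[OF T] by blast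
    then have "T \<inter> {..<m} = T" by auto
    then show "{0..<1} - (\<Union>i\<in>T. B i) \<in> lmeasurable"
      "measure lebesgue ({0..<1} - (\<Union>i\<in>T. B i)) = (\<Prod>i\<in>T. 1 - 1 / 2 ^ a i)"
      using B[of T m] by simp_all
  qed
  have B1: "{0..<1} \<inter> B i \<in> lmeasurable" "measure lebesgue ({0..<1} \<inter> B i) = 1 / 2 ^ a i" for i
  proof -
    have eq: "{0..<1} \<inter> B i = {0..<1} - ({0..<1} - B i)" by auto
    show "{0..<1} \<inter> B i \<in> lmeasurable"
      unfolding eq using fmeasurable_Diff[OF I fmeasurableD[OF fin(1)[of "{i}"]]] by simp
    show "measure lebesgue ({0..<1} \<inter> B i) = 1 / 2 ^ a i"
      unfolding eq using fin[of "{i}"] by (subst measurable_measure_Diff[OF I]) (auto simp: fmeasurableD)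
  qed
  have "\<exists>G. open G \<and> {0..<1} \<inter> B i \<subseteq> G \<and> G \<in> lmeasurable \<and> measure lebesgue G \<le> 2 / 2 ^ a i" for i
  proof -
    obtain G where G: "open G" "{0..<1} \<inter> B i \<subseteq> G" "G - {0..<1} \<inter> B i \<in> lmeasurable"
      "emeasure lebesgue (G - {0..<1} \<inter> B i) < ennreal (1 / 2 ^ a i)"
      using sets_lebesgue_outer_open[OF fmeasurableD[OF B1(1)[of i]], of "1 / 2 ^ a i"] by auto
    have eq: "G = ({0..<1} \<inter> B i) \<union> (G - {0..<1} \<inter> B i)"
      using G(2) by auto
    have "G \<in> lmeasurable"
      by (subst eq) (use G(3) B1 in \<open>blast intro: fmeasurable.Un\<close>)
    moreover have "measure lebesgue (G - {0..<1} \<inter> B i) \<le> 1 / 2 ^ a i"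
      using G(3,4) by (simp add: emeasure_eq_measure2 ennreal_less_iff)
    moreover have "measure lebesgue G \<le> measure lebesgue ({0..<1} \<inter> B i) + measure lebesgue (G - {0..<1} \<inter> B i)"
      by (subst eq, rule measure_Un_le) (use G(3) B1 in \<open>auto simp: fmeasurableD\<close>)
    ultimately show ?thesis
      using G(1,2) B1(2)[of i] by (intro exI[of _ G]) auto
  qed
  then obtain G where G: "\<And>i. open (G i)" "\<And>i. {0..<1} \<inter> B i \<subseteq> G i"
      "\<And>i. G i \<in> lmeasurable" "\<And>i. measure lebesgue (G i) \<le> 2 / 2 ^ a i"
    by metis
  have "measure lebesgue ({0..<1} - (\<Union>i\<in>T. G i)) \<le> (\<Prod>i\<in>T. 1 - 1 / 2 ^ a i)" if T: "finite T" for T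
  proof -
    have "open (\<Union>i\<in>T. G i)"
      using G(1) by auto
    then have "{0..<1} - (\<Union>i\<in>T. G i) \<in> sets lebesgue"
      by (intro sets.Diff) auto
    then have "measure lebesgue ({0..<1} - (\<Union>i\<in>T. G i)) \<le> measure lebesgue ({0..<1} - (\<Union>i\<in>T. B i))"
      by (intro measure_mono_fmeasurable fin(1)[OF T]) (use G(2) in blast)+
    then show ?thesis
      using fin(2)[OF T] by simp
  qed
  with G show ?thesis by blast
qed

section \<open>Capturing functions by slaloms\<close>

lemma min_card_properties:
  assumes "P A"
  shows "\<exists>A. P A \<and> min_card P = |A| \<and> (\<forall>B. P B \<longrightarrow> |A| \<le>o |B| )"
  unfolding min_card_def using someI_ex[OF ex_min_card[of P, OF assms]] by blast

lemma UNIV_real_not_null: "(UNIV :: real set) \<notin> null_sets lebesgue"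
  by (simp add: null_sets_def)

lemma add_null_properties:
  obtains \<A> where "\<A> \<subseteq> null_sets lebesgue" "\<Union>\<A> \<notin> null_sets lebesgue" "add_null = |\<A>|"
    "\<And>\<B> :: real set set. \<B> \<subseteq> null_sets lebesgue \<Longrightarrow> \<Union>\<B> \<notin> null_sets lebesgue \<Longrightarrow> add_null \<le>o |\<B>|"
proof -
  have "range (\<lambda>x :: real. {x}) \<subseteq> null_sets lebesgue \<and> \<Union>(range (\<lambda>x :: real. {x})) \<notin> null_sets lebesgue"
    using UNIV_real_not_null by (auto intro!: null_sets_completionI)
  from min_card_properties[of "\<lambda>\<A>. \<A> \<subseteq> null_sets lebesgue \<and> \<Union>\<A> \<notin> null_sets lebesgue", OF this]
  obtain \<A> where \<A>: "\<A> \<subseteq> null_sets lebesgue" "\<Union>\<A> \<notin> null_sets lebesgue" "add_null = |\<A>|"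
    and min: "\<forall>\<B> :: real set set. \<B> \<subseteq> null_sets lebesgue \<and> \<Union>\<B> \<notin> null_sets lebesgue \<longrightarrow> |\<A>| \<le>o |\<B>|"
    unfolding add_null_def[symmetric] by (elim exE conjE) (rule that)
  show thesis
  proof (rule that[OF \<A>])
    fix \<B> :: "real set set"
    assume "\<B> \<subseteq> null_sets lebesgue" "\<Union>\<B> \<notin> null_sets lebesgue"
    then show "add_null \<le>o |\<B>|"
      unfolding \<A>(3) by (intro min[rule_format] conjI)
  qed
qed

lemma add_null_le:
  fixes \<B> :: "real set set"
  assumes "\<B> \<subseteq> null_sets lebesgue" "\<Union>\<B> \<notin> null_sets lebesgue"
  shows "add_null \<le>o |\<B>|"
  by (rule add_null_properties) (use assms in blast)

lemma Card_order_add_null: "Card_order add_null"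
  by (rule add_null_properties) (metis card_of_Card_order)

lemma infinite_Field_add_null: "infinite (Field add_null)"
proof -
  obtain \<A> where \<A>: "\<A> \<subseteq> null_sets lebesgue" "\<Union>\<A> \<notin> null_sets lebesgue" "add_null = |\<A>|"
    by (rule add_null_properties)
  have "infinite \<A>"
  proof
    assume "finite \<A>"
    then have "\<Union>\<A> \<in> null_sets lebesgue"
      using \<A>(1) null_sets_UN'[of \<A> id] by (auto simp: countable_finite)
    then show False using \<A>(2) by blast
  qed
  then show ?thesis by (simp add: \<A>(3) Field_card_of)
qed

lemma subset_null_lebesgue:
  fixes A B :: "real set"
  shows "A \<in> null_sets lebesgue \<Longrightarrow> B \<subseteq> A \<Longrightarrow> B \<in> null_sets lebesgue"
  using negligible_subset by (simp add: negligible_iff_null_sets)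

section \<open>From small unions of null sets to slaloms\<close>

lemma closed_support:
  fixes K :: "real set"
  assumes "closed K"
  obtains K' where "closed K'" "K' \<subseteq> K" "K - K' \<in> null_sets lebesgue"
    "\<And>U. open U \<Longrightarrow> U \<inter> K' \<noteq> {} \<Longrightarrow> U \<inter> K' \<notin> null_sets lebesgue"
proof -
  obtain \<B> :: "real set set" where \<B>: "countable \<B>" "topological_basis \<B>"
    using ex_countable_basis by blast
  \<comment> \<open>The part of \<open>K\<close> to be removed is covered by basic open sets that
    meet \<open>K\<close> in a null set; as the basis is countable, it is null. No nonempty
    relatively open part of the remainder is null.\<close>
  define \<N> where "\<N> = {U \<in> \<B>. U \<inter> K \<in> null_sets lebesgue}"
  have "countable \<N>"
    using \<B>(1) by (rule countable_subset[rotated]) (auto simp: \<N>_def)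
  then have "(\<Union>U\<in>\<N>. U \<inter> K) \<in> null_sets lebesgue"
    by (rule null_sets_UN') (auto simp: \<N>_def)
  then have null: "K - (K - \<Union>\<N>) \<in> null_sets lebesgue"
    by (rule back_subst[of "\<lambda>X. X \<in> null_sets lebesgue"]) auto
  have op: "open (\<Union>\<N>)"
    using topological_basis_open[OF \<B>(2)] by (auto simp: \<N>_def)
  show thesis
  proof
    show "closed (K - \<Union>\<N>)"
      using assms op by (rule closed_Diff)
    fix U assume U: "open U" "U \<inter> (K - \<Union>\<N>) \<noteq> {}"
    then obtain x where x: "x \<in> U" "x \<in> K" "x \<notin> \<Union>\<N>" by blast
    then obtain V where V: "V \<in> \<B>" "x \<in> V" "V \<subseteq> U"
      using topological_basisE[OF \<B>(2) U(1)] by metis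
    show "U \<inter> (K - \<Union>\<N>) \<notin> null_sets lebesgue"
    proof
      assume "U \<inter> (K - \<Union>\<N>) \<in> null_sets lebesgue"
      then have "U \<inter> (K - \<Union>\<N>) \<union> (K - (K - \<Union>\<N>)) \<in> null_sets lebesgue"
        using null by blast
      then have "V \<inter> K \<in> null_sets lebesgue"
        by (rule subset_null_lebesgue) (use V(3) in auto)
      then show False
        using V x by (auto simp: \<N>_def)
    qed
  qed (use null in auto)
qed


lemma one_minus_power_le_exp: "(1 - 1 / 2 ^ n :: real) ^ (2 ^ n) \<le> exp (- 1)"
proof -
  have "(1 - 1 / 2 ^ n :: real) ^ (2 ^ n) \<le> exp (- 1 / 2 ^ n) ^ (2 ^ n)"
    using exp_ge_add_one_self[of "- 1 / 2 ^ n :: real"]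
    by (intro power_mono) (simp_all add: divide_le_eq)
  also have "\<dots> = exp (- 1)"
    by (simp flip: exp_of_nat_mult)
  finally show ?thesis .
qed

text \<open>Open sets \<open>H n k\<close> of measure at most \<open>2 / 2 ^ n\<close>, enlarged
  from independent ones, turn \<open>f\<close> into the null set \<open>N f\<close> of the points in
  infinitely many \<open>H n (f n)\<close>. As \<open>F\<close> is small, a closed set
  \<open>K\<close> that is not null misses all \<open>N f\<close>. Baire's theorem yields for each
  \<open>f\<close> an open part of \<open>K\<close> avoided by almost all \<open>H n (f n)\<close>;
  by independence a fixed part is avoided for few \<open>k\<close>, and the slalom collects these
  \<open>k\<close>.\<close>

lemma ex_slalom_capturing_nat:
  fixes F :: "(nat \<Rightarrow> nat) set"
  assumes F: "|F| <o add_null"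
  shows "\<exists>S. (\<forall>n. finite (S n) \<and> card (S n) \<le> 4 ^ n) \<and> (\<forall>f\<in>F. \<forall>\<^sub>\<infinity>n. f n \<in> S n)"
proof -
  \<comment> \<open>One sequence, indexed by codes of pairs \<open>(n, k)\<close>; the bound on the
    measure depends on \<open>n\<close> only.\<close>
  obtain G :: "nat \<Rightarrow> real set" where
    G: "\<And>i. open (G i)" "\<And>i. G i \<in> lmeasurable"
      "\<And>i. measure lebesgue (G i) \<le> 2 / 2 ^ fst (prod_decode i)"
      "\<And>T. finite T \<Longrightarrow> measure lebesgue ({0..<1} - (\<Union>i\<in>T. G i)) \<le> (\<Prod>i\<in>T. 1 - 1 / 2 ^ fst (prod_decode i))"
    using ex_open_independent_sets[of "\<lambda>i. fst (prod_decode i)"] by blast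
  define H where "H n k = G (prod_encode (n, k))" for n k
  have H: "open (H n k)" "H n k \<in> lmeasurable" "measure lebesgue (H n k) \<le> 2 / 2 ^ n" for n k
    using G(1,2) G(3)[of "prod_encode (n, k)"] by (simp_all add: H_def)
  define N where "N f = limsup (\<lambda>n. H n (f n))" for f
  have N: "N f \<in> null_sets lebesgue" for f
    unfolding N_def
  proof (rule borel_cantelli_limsup1)
    show "summable (\<lambda>n. measure lebesgue (H n (f n)))"
    proof (rule summable_comparison_test')
      show "summable (\<lambda>n. 2 * (1 / 2) ^ n :: real)"
        by (intro summable_mult summable_geometric) simp
      show "norm (measure lebesgue (H n (f n))) \<le> 2 * (1 / 2) ^ n" if "n \<ge> 0" for n
        using H(3)[of n "f n"] by (simp add: power_divide)
    qed
    show "H n (f n) \<in> sets lebesgue" "emeasure lebesgue (H n (f n)) < \<infinity>" for n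
      using fmeasurableD[OF H(2)] fmeasurableD2[OF H(2)] by (simp_all only: infinity_ennreal_def less_top)
  qed
  define Z where "Z = \<Union>(N ` F)"
  have Z: "Z \<in> null_sets lebesgue"
  proof (rule ccontr)
    assume "Z \<notin> null_sets lebesgue"
    then have "add_null \<le>o |N ` F|"
      unfolding Z_def using N by (intro add_null_le) auto
    then have "add_null \<le>o |F|"
      using card_of_image ordLeq_transitive by blast
    then show False
      using F not_ordLess_ordLeq by blast
  qed
  have I: "({0..<1} :: real set) \<in> lmeasurable"
    by (rule bounded_set_imp_lmeasurable) auto
  have "{0..<1} - Z \<in> sets lebesgue"
    using I Z by (auto simp: fmeasurableD)
  \<comment> \<open>Tolerance \<open>1\<close> suffices: \<open>{0..<1} - Z\<close> has measure
    \<open>1\<close>, so removing less than that leaves a set that is not null.\<close>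
  then obtain K0 where K0: "closed K0" "K0 \<subseteq> {0..<1} - Z" "({0..<1} - Z) - K0 \<in> lmeasurable"
    "emeasure lebesgue (({0..<1} - Z) - K0) < ennreal 1"
    using sets_lebesgue_inner_closed[of "{0..<1} - Z" 1] by auto
  have K0': "K0 \<notin> null_sets lebesgue"
  proof
    assume "K0 \<in> null_sets lebesgue"
    then have "measure lebesgue (({0..<1} - Z) - K0) = 1"
      using Z I by (simp add: measure_Diff_null_set fmeasurableD sets.Diff null_setsD2)
    then show False
      using K0(3,4) by (simp add: emeasure_eq_measure2)
  qed
  obtain K where K: "closed K" "K \<subseteq> K0" "K0 - K \<in> null_sets lebesgue"
    "\<And>U. open U \<Longrightarrow> U \<inter> K \<noteq> {} \<Longrightarrow> U \<inter> K \<notin> null_sets lebesgue"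
    using closed_support[OF K0(1)] by metis
  have Kne: "K \<noteq> {}"
    using K(3) K0' by auto
  have Kmeas: "U \<inter> K \<in> lmeasurable" if "open U" for U
    by (rule fmeasurableI2[OF I]) (use K K0 that in auto)
  \<comment> \<open>If more than \<open>2 ^ n\<close> values were avoided for infinitely many
    \<open>n\<close>, choosing \<open>2 ^ n\<close> of them for each of \<open>r\<close> such
    \<open>n\<close> would bound the measure of \<open>U \<inter> K\<close> by
    \<open>exp (- r)\<close>: each \<open>n\<close> contributes the factor
    \<open>(1 - 1 / 2 ^ n) ^ (2 ^ n)\<close>.\<close>
  have card_avoid: "\<forall>\<^sub>\<infinity>n. finite {k. U \<inter> K \<inter> H n k = {}} \<and> card {k. U \<inter> K \<inter> H n k = {}} \<le> 2 ^ n"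
    if U: "open U" "U \<inter> K \<noteq> {}" for U
  proof (rule ccontr)
    define A where "A n = {k. U \<inter> K \<inter> H n k = {}}" for n
    define X where "X = {n. \<not> (finite (A n) \<and> card (A n) \<le> 2 ^ n)}"
    assume "\<not> ?thesis"
    then have "infinite X"
      by (simp add: X_def A_def INFM_iff_infinite)
    have "measure lebesgue (U \<inter> K) \<noteq> 0"
      using K(4)[OF U] Kmeas[OF U(1)] by (auto simp: null_sets_def emeasure_eq_measure2 fmeasurableD)
    then have pos: "measure lebesgue (U \<inter> K) > 0"
      by (simp add: zero_less_measure_iff)
    obtain r :: nat where "- ln (measure lebesgue (U \<inter> K)) < r"
      using reals_Archimedean2 by blast
    then have "exp (- real r) < exp (ln (measure lebesgue (U \<inter> K)))"
      by simp
    then have r: "exp (- real r) < measure lebesgue (U \<inter> K)"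
      using pos by simp
    obtain X0 where X0: "X0 \<subseteq> X" "finite X0" "card X0 = r"
      using infinite_arbitrarily_large[OF \<open>infinite X\<close>] by metis
    have "\<exists>C. C \<subseteq> A n \<and> finite C \<and> card C = 2 ^ n" if "n \<in> X0" for n
    proof (cases "finite (A n)")
      case True
      then have "2 ^ n \<le> card (A n)"
        using that X0(1) by (auto simp: X_def)
      then obtain C where "C \<subseteq> A n" "card C = 2 ^ n" "finite C"
        using obtain_subset_with_card_n by metis
      then show ?thesis by blast
    next
      case False
      then show ?thesis
        using infinite_arbitrarily_large by blast
    qed
    then obtain C where C: "\<And>n. n \<in> X0 \<Longrightarrow> C n \<subseteq> A n" "\<And>n. n \<in> X0 \<Longrightarrow> finite (C n)"
        "\<And>n. n \<in> X0 \<Longrightarrow> card (C n) = 2 ^ n"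
      by metis
    define T where "T = prod_encode ` (SIGMA n:X0. C n)"
    have finT: "finite T"
      unfolding T_def using X0(2) C(2) by auto
    have "U \<inter> K \<subseteq> {0..<1} - (\<Union>i\<in>T. G i)"
    proof
      fix x assume x: "x \<in> U \<inter> K"
      have "x \<notin> G (prod_encode (n, k))" if "n \<in> X0" "k \<in> C n" for n k
        using C(1)[OF that(1)] that(2) x unfolding A_def H_def by blast
      then show "x \<in> {0..<1} - (\<Union>i\<in>T. G i)"
        using x K(2) K0(2) unfolding T_def by auto
    qed
    moreover have "{0..<1} - (\<Union>i\<in>T. G i) \<in> lmeasurable"
      using I G(2) finT by (intro fmeasurable_Diff) (auto simp: fmeasurableD)
    ultimately have "measure lebesgue (U \<inter> K) \<le> measure lebesgue ({0..<1} - (\<Union>i\<in>T. G i))"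
      using Kmeas[OF U(1)] by (intro measure_mono_fmeasurable) (auto simp: fmeasurableD)
    also have "\<dots> \<le> (\<Prod>i\<in>T. 1 - 1 / 2 ^ fst (prod_decode i))"
      by (rule G(4)[OF finT])
    also have "\<dots> = (\<Prod>(n, k)\<in>(SIGMA n:X0. C n). 1 - 1 / 2 ^ n)"
      unfolding T_def by (subst prod.reindex) (auto simp: inj_on_def case_prod_unfold)
    also have "\<dots> = (\<Prod>n\<in>X0. (1 - 1 / 2 ^ n) ^ (2 ^ n))"
      using X0(2) C(2,3) by (subst prod.Sigma[symmetric]) auto
    also have "\<dots> \<le> (\<Prod>n\<in>X0. exp (- 1))"
      using one_minus_power_le_exp by (intro prod_mono) auto
    also have "\<dots> = exp (- real r)"
      by (simp add: X0(3) flip: exp_of_nat_mult)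
    finally show False using r by simp
  qed
  obtain \<B> :: "real set set" where \<B>: "countable \<B>" "topological_basis \<B>"
    using ex_countable_basis by blast
  define \<U> where "\<U> = {U \<in> \<B>. U \<inter> K \<noteq> {}}"
  \<comment> \<open>Otherwise every \<open>W m\<close> is relatively open and dense in
    \<open>K\<close>, so by Baire's theorem the intersection is dense in \<open>K\<close>; but it
    lies in \<open>N f\<close>, which misses \<open>K\<close>.\<close>
  have avoid: "\<exists>U\<in>\<U>. \<exists>m. \<forall>n\<ge>m. U \<inter> K \<inter> H n (f n) = {}" if f: "f \<in> F" for f
  proof (rule ccontr)
    assume neg: "\<not> ?thesis"
    define W where "W m = K \<inter> (\<Union>n\<in>{m..}. H n (f n))" for m
    have "K \<subseteq> closure (\<Inter>(range W))"
    proof (rule Baire[OF K(1)])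
      fix T assume "T \<in> range W"
      then obtain m where T: "T = W m" by blast
      have "openin (top_of_set K) (W m)"
        unfolding W_def using H(1) by (intro openin_open_Int open_UN) auto
      moreover have "K \<subseteq> closure (W m)"
      proof
        fix x assume x: "x \<in> K"
        show "x \<in> closure (W m)"
        proof (rule ccontr)
          assume "x \<notin> closure (W m)"
          then obtain V where V: "V \<in> \<B>" "x \<in> V" "V \<subseteq> - closure (W m)"
            using topological_basisE[OF \<B>(2), of "- closure (W m)" x] by auto
          have "V \<in> \<U>"
            using V x by (auto simp: \<U>_def)
          then obtain n where "n \<ge> m" "V \<inter> K \<inter> H n (f n) \<noteq> {}"
            using neg by blast
          then have "V \<inter> W m \<noteq> {}"
            unfolding W_def by auto
          then show False
            using V(3) closure_subset by blast
        qed
      qed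
      ultimately show "openin (top_of_set K) T \<and> K \<subseteq> closure T"
        by (simp add: T)
    qed auto
    moreover have "\<Inter>(range W) \<subseteq> K \<inter> N f"
      unfolding W_def N_def limsup_INF_SUP by blast
    moreover have "K \<inter> N f = {}"
      using f K(2) K0(2) unfolding Z_def by blast
    ultimately have "K \<subseteq> closure {}"
      by (metis subset_empty)
    then show False
      using Kne by simp
  qed
  have "countable \<U>"
    using \<B>(1) by (rule countable_subset[rotated]) (auto simp: \<U>_def)
  moreover have "\<U> \<noteq> {}"
  proof -
    obtain x where x: "x \<in> K" using Kne by blast
    obtain V where "V \<in> \<B>" "x \<in> V"
      using topological_basisE[OF \<B>(2) open_UNIV UNIV_I] by metis
    then show ?thesis
      using x by (auto simp: \<U>_def)
  qed
  ultimately have "range (from_nat_into \<U>) = \<U>"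
    by (intro range_from_nat_into)
  then obtain u :: "nat \<Rightarrow> real set" where u: "range u = \<U>"
    by (rule that)
  have "\<forall>i. \<exists>m. \<forall>n\<ge>m. finite {k. u i \<inter> K \<inter> H n k = {}} \<and> card {k. u i \<inter> K \<inter> H n k = {}} \<le> 2 ^ n"
  proof
    fix i
    have "u i \<in> \<U>" using u by blast
    then have "open (u i)" "u i \<inter> K \<noteq> {}"
      using topological_basis_open[OF \<B>(2)] by (auto simp: \<U>_def)
    then show "\<exists>m. \<forall>n\<ge>m. finite {k. u i \<inter> K \<inter> H n k = {}} \<and> card {k. u i \<inter> K \<inter> H n k = {}} \<le> 2 ^ n"
      using card_avoid[of "u i"] unfolding MOST_nat_le by simp
  qed
  then obtain m where m: "\<And>i n. n \<ge> m i \<Longrightarrow> finite {k. u i \<inter> K \<inter> H n k = {}}"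
      "\<And>i n. n \<ge> m i \<Longrightarrow> card {k. u i \<inter> K \<inter> H n k = {}} \<le> 2 ^ n"
    by metis
  \<comment> \<open>At \<open>n\<close> only those of the first \<open>n + 1\<close> basic sets
    count whose bound is already valid; this gives at most \<open>(n + 1) * 2 ^ n\<close>
    values.\<close>
  define S where "S n = (\<Union>i\<in>{i. i \<le> n \<and> m i \<le> n}. {k. u i \<inter> K \<inter> H n k = {}})" for n
  have "finite (S n) \<and> card (S n) \<le> 4 ^ n" for n
  proof
    show "finite (S n)"
      unfolding S_def using m(1) by auto
    have "card (S n) \<le> (\<Sum>i\<in>{i. i \<le> n \<and> m i \<le> n}. card {k. u i \<inter> K \<inter> H n k = {}})"
      unfolding S_def by (rule card_UN_le) auto
    also have "\<dots> \<le> (\<Sum>i\<in>{i. i \<le> n \<and> m i \<le> n}. 2 ^ n)"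
      using m(2) by (intro sum_mono) auto
    also have "\<dots> \<le> (\<Sum>i\<in>{..n}. 2 ^ n)"
      by (rule sum_mono2) auto
    also have "\<dots> = Suc n * 2 ^ n"
      by simp
    also have "\<dots> \<le> 2 ^ n * 2 ^ n"
      using less_exp[of n] by (intro mult_right_mono) (simp_all only: Suc_le_eq)
    finally show "card (S n) \<le> 4 ^ n"
      by (simp flip: power_mult_distrib)
  qed
  moreover have "\<forall>\<^sub>\<infinity>n. f n \<in> S n" if f: "f \<in> F" for f
  proof -
    obtain i l where il: "\<And>n. n \<ge> l \<Longrightarrow> u i \<inter> K \<inter> H n (f n) = {}"
      using avoid[OF f] u by blast
    have "f n \<in> S n" if "n \<ge> max l (max i (m i))" for n
      using that il[of n] unfolding S_def by auto
    then show ?thesis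
      unfolding MOST_nat_le by blast
  qed
  ultimately show ?thesis by blast
qed

text \<open>The hard half of Bartoszynski's characterization of the additivity of the null ideal.\<close>

lemma ex_slalom_capturing:
  fixes F :: "(nat \<Rightarrow> 'a :: countable) set"
  assumes "|F| <o add_null"
  shows "\<exists>S. (\<forall>n. finite (S n) \<and> card (S n) \<le> 4 ^ n) \<and> (\<forall>f\<in>F. \<forall>\<^sub>\<infinity>n. f n \<in> S n)"
proof -
  from ex_slalom_capturing_nat[OF ordLeq_ordLess_trans[OF card_of_image[of "\<lambda>f. to_nat \<circ> f"] assms]]
  obtain S where "\<forall>n. finite (S n) \<and> card (S n) \<le> 4 ^ n"
    "\<forall>f\<in>(\<lambda>f. to_nat \<circ> f) ` F. \<forall>\<^sub>\<infinity>n. f n \<in> S n"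
    by (elim exE conjE)
  then have S: "\<And>n. finite (S n)" "\<And>n. card (S n) \<le> 4 ^ n"
      "\<And>f. f \<in> F \<Longrightarrow> \<forall>\<^sub>\<infinity>n. to_nat (f n) \<in> S n"
    by simp_all
  have "\<forall>\<^sub>\<infinity>n. f n \<in> from_nat ` S n" if "f \<in> F" for f
    using S(3)[OF that] by (rule MOST_mono) (metis from_nat_to_nat image_eqI)
  then show ?thesis
    using S(1,2) by (intro exI[of _ "\<lambda>n. from_nat ` S n"]) (auto intro: order_trans[OF card_image_le])
qed

section \<open>Narrow slaloms\<close>

text \<open>Width \<open>o(n)\<close>, stated without division. Unlike a fixed bound on the width,
  this is preserved by finite unions.\<close>

definition narrow_slaloms :: "(nat \<Rightarrow> nat set) set" where
  "narrow_slaloms = {\<phi>. (\<forall>n. finite (\<phi> n)) \<and> (\<forall>k. \<forall>\<^sub>\<infinity>n. k * card (\<phi> n) \<le> n)}"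

lemma narrow_slaloms_Un:
  assumes "\<phi> \<in> narrow_slaloms" "\<psi> \<in> narrow_slaloms"
  shows "(\<lambda>n. \<phi> n \<union> \<psi> n) \<in> narrow_slaloms"
proof -
  have "\<forall>\<^sub>\<infinity>n. k * card (\<phi> n \<union> \<psi> n) \<le> n" for k
  proof -
    have "\<forall>\<^sub>\<infinity>n. (2 * k) * card (\<phi> n) \<le> n" "\<forall>\<^sub>\<infinity>n. (2 * k) * card (\<psi> n) \<le> n"
      using assms unfolding narrow_slaloms_def by blast+
    then have "\<forall>\<^sub>\<infinity>n. (2 * k) * card (\<phi> n) \<le> n \<and> (2 * k) * card (\<psi> n) \<le> n"
      by (rule MOST_conjI)
    then show ?thesis
    proof (rule MOST_mono)
      fix n
      have "k * card (\<phi> n \<union> \<psi> n) \<le> k * (card (\<phi> n) + card (\<psi> n))"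
        by (intro mult_left_mono card_Un_le) simp
      then show "k * card (\<phi> n \<union> \<psi> n) \<le> n"
        if "(2 * k) * card (\<phi> n) \<le> n \<and> (2 * k) * card (\<psi> n) \<le> n"
        using that by (simp add: distrib_left)
    qed
  qed
  then show ?thesis
    using assms unfolding narrow_slaloms_def by auto
qed

lemma strict_mono_majorant:
  fixes S :: "nat \<Rightarrow> nat set"
  assumes "\<And>n. finite (S n)"
  obtains M where "strict_mono M" "\<And>n i. i \<in> S n \<Longrightarrow> i \<le> M n"
proof
  define M where "M n = (\<Sum>m\<le>n. \<Sum>(S m)) + n" for n
  show "strict_mono M"
    by (rule strict_monoI_Suc) (simp add: M_def)
  fix n i assume i: "i \<in> S n"
  have "i \<le> \<Sum>(S n)"
    using sum_nonneg_leq_bound[of "S n" "\<lambda>x. x"] member_le_sum[OF i, of "\<lambda>x. x"] assms by simp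
  also have "\<dots> \<le> (\<Sum>m\<le>n. \<Sum>(S m))"
    by (rule member_le_sum[of n "{..n}" "\<lambda>m. \<Sum>(S m)"]) auto
  finally show "i \<le> M n"
    by (simp add: M_def)
qed

text \<open>A common eventual bound \<open>M\<close> for the rates at which the members of
  \<open>X\<close> become narrow cuts \<omega> into blocks. A second capturing guesses each member
  on whole blocks, and the guesses that are narrow enough are united. On block \<open>j\<close> at
  most \<open>4 ^ j\<close> guesses of size at most \<open>n / 8 ^ j\<close> yield a union of size
  at most \<open>n / 2 ^ j\<close>.\<close>

lemma narrow_slaloms_directed:
  assumes X: "X \<subseteq> narrow_slaloms" and card: "|X| <o add_null"
  shows "\<exists>\<psi>\<in>narrow_slaloms. \<forall>\<phi>\<in>X. \<forall>\<^sub>\<infinity>n. \<phi> n \<subseteq> \<psi> n"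
proof -
  have "\<exists>m. \<forall>n\<ge>m. 8 ^ j * card (\<phi> n) \<le> n" if "\<phi> \<in> X" for \<phi> j
    using X that unfolding narrow_slaloms_def MOST_nat_le by blast
  then obtain m where m: "\<And>\<phi> j n. \<phi> \<in> X \<Longrightarrow> n \<ge> m \<phi> j \<Longrightarrow> 8 ^ j * card (\<phi> n) \<le> n"
    by metis
  from ex_slalom_capturing[OF ordLeq_ordLess_trans[OF card_of_image[of m] card]]
  obtain S where S: "\<And>n. finite (S n)" "\<forall>f\<in>m ` X. \<forall>\<^sub>\<infinity>n. f n \<in> S n"
    by blast
  obtain M where M: "strict_mono M" "\<And>n i. i \<in> S n \<Longrightarrow> i \<le> M n"
    using strict_mono_majorant[of S] S(1) by metis
  have mM: "\<forall>\<^sub>\<infinity>j. m \<phi> j \<le> M j" if "\<phi> \<in> X" for \<phi>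
    by (rule MOST_mono[OF S(2)[rule_format, OF imageI[OF that]]]) (rule M(2))
  \<comment> \<open>The code covers all \<open>n\<close> below the end of block \<open>j\<close>,
    not only the block, so that \<open>n\<close> itself is the position in the list.\<close>
  define c where "c \<phi> j = map (\<lambda>n. set_encode (\<phi> n)) [0..<M (Suc j)]" for \<phi> j
  from ex_slalom_capturing[OF ordLeq_ordLess_trans[OF card_of_image[of c] card]]
  obtain T where T: "\<And>j. finite (T j)" "\<And>j. card (T j) \<le> 4 ^ j" "\<forall>f\<in>c ` X. \<forall>\<^sub>\<infinity>j. f j \<in> T j"
    by blast
  \<comment> \<open>The block containing \<open>n\<close>. Block \<open>0\<close> also receives the
    \<open>n\<close> below \<open>M 0\<close>, whence the premise of \<open>J2\<close>.\<close>
  define J where "J n = (LEAST j. n < M (Suc j))" for n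
  have "n < M (Suc n)" for n
    using strict_mono_imp_increasing[OF M(1), of "Suc n"] by simp
  then have J1: "n < M (Suc (J n))" for n
    unfolding J_def by (rule LeastI)
  have J2: "M (J n) \<le> n" if "J n > 0" for n
    using that not_less_Least[of "J n - 1" "\<lambda>j. n < M (Suc j)"] unfolding J_def[symmetric] by simp
  have J3: "j \<le> J n" if "n \<ge> M j" for n j
  proof (rule ccontr)
    assume "\<not> j \<le> J n"
    then have "M (Suc (J n)) \<le> M j"
      using M(1) by (simp add: strict_mono_less_eq)
    then show False using J1[of n] that by simp
  qed
  \<comment> \<open>Wrong guesses are captured too; discarding those too large at \<open>n\<close>
    makes the bound on \<open>\<psi>\<close> hold at every \<open>n\<close>.\<close>
  define U where "U n = {s \<in> T (J n). 8 ^ J n * card (set_decode (s ! n)) \<le> n}" for n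
  define \<psi> where "\<psi> n = (\<Union>s\<in>U n. set_decode (s ! n))" for n
  have U: "finite (U n)" "card (U n) \<le> 4 ^ J n" for n
    using T(1) order_trans[OF card_mono T(2)] by (auto simp: U_def)
  have card_\<psi>: "2 ^ J n * card (\<psi> n) \<le> n" for n
  proof -
    have "8 ^ J n * card (\<psi> n) \<le> 8 ^ J n * (\<Sum>s\<in>U n. card (set_decode (s ! n)))"
      unfolding \<psi>_def using U(1) by (intro mult_left_mono card_UN_le) auto
    also have "\<dots> = (\<Sum>s\<in>U n. 8 ^ J n * card (set_decode (s ! n)))"
      by (rule sum_distrib_left)
    also have "\<dots> \<le> (\<Sum>s\<in>U n. n)"
      by (rule sum_mono) (simp add: U_def)
    also have "\<dots> \<le> 4 ^ J n * n"
      using U(2) by simp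
    finally have "4 ^ J n * (2 ^ J n * card (\<psi> n)) \<le> 4 ^ J n * n"
      by (simp add: mult.assoc[symmetric] flip: power_mult_distrib)
    then show ?thesis by simp
  qed
  have "\<forall>\<^sub>\<infinity>n. k * card (\<psi> n) \<le> n" for k
    unfolding MOST_nat_le
  proof (intro exI allI impI)
    fix n assume "M k \<le> n"
    then have "k \<le> J n" by (rule J3)
    then have "k \<le> 2 ^ J n"
      using less_exp[of "J n"] by linarith
    then have "k * card (\<psi> n) \<le> 2 ^ J n * card (\<psi> n)"
      by (rule mult_right_mono) simp
    then show "k * card (\<psi> n) \<le> n"
      using card_\<psi> order_trans by blast
  qed
  moreover have "finite (\<psi> n)" for n
    unfolding \<psi>_def using U(1) by auto
  ultimately have "\<psi> \<in> narrow_slaloms"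
    unfolding narrow_slaloms_def by blast
  moreover have "\<forall>\<^sub>\<infinity>n. \<phi> n \<subseteq> \<psi> n" if \<phi>: "\<phi> \<in> X" for \<phi>
  proof -
    have "\<forall>\<^sub>\<infinity>j. m \<phi> j \<le> M j \<and> c \<phi> j \<in> T j"
      using mM[OF \<phi>] T(3)[rule_format, OF imageI[OF \<phi>]] by (rule MOST_conjI)
    then obtain j0 where j0: "\<And>j. j \<ge> j0 \<Longrightarrow> m \<phi> j \<le> M j \<and> c \<phi> j \<in> T j"
      unfolding MOST_nat_le by blast
    show ?thesis
      unfolding MOST_nat_le
    proof (intro exI allI impI)
      \<comment> \<open>Starting at \<open>M (Suc j0)\<close> rather than \<open>M j0\<close> forces
        \<open>J n > 0\<close>, so that \<open>J2\<close> applies.\<close>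
      fix n assume "M (Suc j0) \<le> n"
      then have J: "Suc j0 \<le> J n" by (rule J3)
      then have j: "m \<phi> (J n) \<le> M (J n)" "c \<phi> (J n) \<in> T (J n)" "M (J n) \<le> n"
        using j0[of "J n"] J2[of n] by auto
      have "finite (\<phi> n)"
        using \<phi> X unfolding narrow_slaloms_def by blast
      then have dec: "set_decode (c \<phi> (J n) ! n) = \<phi> n"
        using J1[of n] by (simp add: c_def)
      have "c \<phi> (J n) \<in> U n"
        using m[OF \<phi>, of "J n" n] j by (simp add: U_def dec)
      then show "\<phi> n \<subseteq> \<psi> n"
        unfolding \<psi>_def using dec by blast
    qed
  qed
  ultimately show ?thesis by blast
qed

section \<open>Narrowing a covering family for \<open>H2\<close>\<close>

lemma floor_log_div_2:
  assumes "n > 0"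
  shows "4 ^ (floor_log n div 2) \<le> n" "n < 4 ^ Suc (floor_log n div 2)"
proof -
  have "(4 :: nat) ^ (floor_log n div 2) = 2 ^ (2 * (floor_log n div 2))"
    by (simp add: power_mult)
  also have "\<dots> \<le> 2 ^ floor_log n"
    by (rule power_increasing) auto
  also have "\<dots> \<le> n"
    using assms by (rule floor_log_exp2_le)
  finally show "4 ^ (floor_log n div 2) \<le> n" .
  have "n < 2 * 2 ^ floor_log n"
    by (rule floor_log_exp2_gt)
  also have "\<dots> = 2 ^ Suc (floor_log n)"
    by simp
  also have "\<dots> \<le> 2 ^ (2 * Suc (floor_log n div 2))"
    by (rule power_increasing) auto
  also have "\<dots> = 4 ^ Suc (floor_log n div 2)"
    by (subst power_mult) simp
  finally show "n < 4 ^ Suc (floor_log n div 2)" .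
qed

lemma le_floor_log_div_2: "4 ^ m \<le> n \<Longrightarrow> m \<le> floor_log n div 2"
proof -
  assume "4 ^ m \<le> n"
  then have "(2 :: nat) ^ (2 * m) \<le> n"
    by (simp add: power_mult)
  then have "floor_log (2 ^ (2 * m)) \<le> floor_log n"
    by (rule floor_log_le_iff)
  then show ?thesis by simp
qed

lemma set_encode_less:
  assumes "A \<subseteq> {..<k}"
  shows "set_encode A < 2 ^ k"
proof -
  have "set_encode A \<le> (\<Sum>i<k. 2 ^ i)"
    unfolding set_encode_def using assms by (intro sum_mono2) auto
  also have "\<dots> < 2 ^ k"
    by (induction k) auto
  finally show ?thesis .
qed

text \<open>The room in the exponent of \<open>H2\<close>: \<open>n ^ 4\<close> exceeds both
  \<open>Suc n\<close>, needed to code subsets of \<open>{..<2 ^ Suc n}\<close>, and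
  \<open>4 * n + 4\<close>, needed to code the right guesses.\<close>

lemma power4_ge:
  fixes n :: nat
  assumes "n \<ge> 2"
  shows "8 * n \<le> n ^ 4"
proof -
  have "2 ^ 3 \<le> n ^ 3"
    using assms by (intro power_mono) auto
  then have "8 * n \<le> n ^ 3 * n"
    by (intro mult_right_mono) auto
  then show ?thesis
    by (simp add: numeral_eq_Suc)
qed

text \<open>With \<open>N = 4 ^ Suc m\<close> there are at most \<open>2 ^ (N * N)\<close> choices,
  and \<open>N * N = 2 ^ (4 * m + 4)\<close>.\<close>

lemma card_digit_functions_le_H2:
  assumes "m \<ge> 2"
  shows "card (\<Pi>\<^sub>E n\<in>{..<4 ^ Suc m}. {..<2 ^ n :: nat}) \<le> H2 m"
proof -
  let ?N = "4 ^ Suc m :: nat"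
  have "card (\<Pi>\<^sub>E n\<in>{..<?N}. {..<2 ^ n :: nat}) = (\<Prod>n<?N. 2 ^ n)"
    by (subst card_PiE) auto
  also have "\<dots> = 2 ^ (\<Sum>n<?N. n)"
    by (simp add: power_sum)
  also have "(\<Sum>n<?N. n) \<le> (\<Sum>n<?N. ?N)"
    by (rule sum_mono) auto
  also have "\<dots> = 2 ^ (4 * m + 4)"
    by (simp add: power_mult power_add flip: power_mult_distrib)
  also have "4 * m + 4 \<le> m ^ 4"
    using power4_ge[OF assms] assms by simp
  finally show ?thesis
    by (simp add: H2_def)
qed


lemma ex_digit_code:
  "\<exists>c d. (\<forall>m i. c m i < H2 m) \<and>
    (\<forall>m\<ge>2. \<forall>i. (\<forall>n. i n < (2 :: nat) ^ n) \<longrightarrow> (\<forall>n<4 ^ Suc m. d m (c m i) n = i n))"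
proof -
  let ?P = "\<lambda>m. \<Pi>\<^sub>E n\<in>{..<4 ^ Suc m}. {..<2 ^ n :: nat}"
  have "\<exists>g. inj_on g (?P m) \<and> g ` ?P m \<subseteq> {..<H2 m}" if "m \<ge> 2" for m
    using card_digit_functions_le_H2[OF that] card_le_inj[of "?P m" "{..<H2 m}"]
    by (auto simp: finite_PiE)
  then obtain g where g: "\<And>m. m \<ge> 2 \<Longrightarrow> inj_on (g m) (?P m)" "\<And>m. m \<ge> 2 \<Longrightarrow> g m ` ?P m \<subseteq> {..<H2 m}"
    by metis
  define r where "r m i = restrict i {..<4 ^ Suc m}" for m and i :: "nat \<Rightarrow> nat"
  \<comment> \<open>For \<open>m < 2\<close>, where no injection was obtained, and for unbounded
    \<open>i\<close> the code is \<open>0\<close>, which also lies below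
    \<open>H2 m\<close>.\<close>
  define c where "c m i = (if m \<ge> 2 \<and> (\<forall>n. i n < 2 ^ n) then g m (r m i) else 0)" for m i
  show ?thesis
  proof (intro exI[of _ c] exI[of _ "\<lambda>m. inv_into (?P m) (g m)"] conjI allI impI)
    have rP: "r m i \<in> ?P m" if "\<forall>n. i n < 2 ^ n" for m i
      using that by (auto simp: r_def)
    show "c m i < H2 m" for m i
      using g(2)[of m] rP[of i m] by (auto simp: c_def H2_def image_subset_iff)
    show "inv_into (?P m) (g m) (c m i) n = i n"
      if "m \<ge> 2" "\<forall>n. i n < 2 ^ n" "n < 4 ^ Suc m" for m i n
    proof -
      have "inv_into (?P m) (g m) (c m i) = r m i"
        using g(1)[OF that(1)] rP that(1,2) by (simp add: c_def inv_into_f_f)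
      then show ?thesis
        using that(3) by (simp add: r_def)
    qed
  qed
qed

text \<open>A slalom of width \<open>2 ^ n\<close> is narrowed by predicting, with a second member of \<open>\<Phi>\<close>, which of
  its \<open>2 ^ n\<close> guesses is the right one: for all \<open>n < 4 ^ Suc m\<close> together, the numbers of the right guesses
  have a code below \<open>H2 m\<close>, and for this code there are only \<open>2 ^ m\<close> guesses.\<close>

lemma ex_narrow_cover:
  assumes \<Phi>: "\<Phi> \<subseteq> slaloms" and cov: "\<forall>f\<in>(\<Pi> n\<in>UNIV. {..<H2 n}). \<exists>\<phi>\<in>\<Phi>. f \<sqsubseteq>\<^sub>s \<phi>"
  shows "\<exists>\<Psi>\<subseteq>narrow_slaloms. |\<Psi>| \<le>o |\<Phi> \<times> \<Phi>| \<and>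
    (\<forall>A. \<exists>\<psi>\<in>\<Psi>. \<forall>\<^sub>\<infinity>n. set_encode (A \<inter> {..<2 ^ Suc n}) \<in> \<psi> n)"
proof -
  \<comment> \<open>The guesses of \<open>\<phi> n\<close> are numbered by indices below
    \<open>2 ^ n\<close>; spare indices may have any value.\<close>
  have "\<exists>e. \<phi> n \<subseteq> e ` {..<2 ^ n :: nat}" if "\<phi> \<in> \<Phi>" for \<phi> n
  proof -
    have fin: "finite (\<phi> n)" "card (\<phi> n) \<le> 2 ^ n"
      using \<Phi> that unfolding slaloms_def by blast+
    obtain e where "bij_betw e {..<card (\<phi> n)} (\<phi> n)"
      using ex_bij_betw_nat_finite[OF fin(1)] by (auto simp: atLeast0LessThan)
    then have "\<phi> n = e ` {..<card (\<phi> n)}"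
      by (simp add: bij_betw_def)
    also have "\<dots> \<subseteq> e ` {..<2 ^ n}"
      using fin(2) by (intro image_mono) auto
    finally show ?thesis by blast
  qed
  then obtain e where e: "\<And>\<phi> n. \<phi> \<in> \<Phi> \<Longrightarrow> \<phi> n \<subseteq> e \<phi> n ` {..<2 ^ n :: nat}"
    by metis
  obtain c :: "nat \<Rightarrow> (nat \<Rightarrow> nat) \<Rightarrow> nat" and d :: "nat \<Rightarrow> nat \<Rightarrow> nat \<Rightarrow> nat"
    where c: "\<And>m i. c m i < H2 m"
    and d: "\<forall>m\<ge>2. \<forall>i. (\<forall>n. i n < 2 ^ n) \<longrightarrow> (\<forall>n<4 ^ Suc m. d m (c m i) n = i n)"
    using ex_digit_code by blast
  \<comment> \<open>The integer logarithm of \<open>n\<close> to base 4 for \<open>n > 0\<close>, so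
    that \<open>2 ^ M n\<close> is about the square root of \<open>n\<close>.\<close>
  define M where "M n = floor_log n div 2" for n :: nat
  \<comment> \<open>A member \<open>s\<close> of \<open>\<theta> (M n)\<close> is a guess at the
    code of a long list of indices; its entry at \<open>n\<close> picks one guess of
    \<open>\<phi> n\<close>. The width at \<open>n\<close> is thus at most that of
    \<open>\<theta>\<close> at \<open>M n\<close>.\<close>
  define F where "F = (\<lambda>(\<phi>, \<theta>) n. (\<lambda>s. e \<phi> n (d (M n) s n)) ` \<theta> (M n))"
  have "F p \<in> narrow_slaloms" if "p \<in> \<Phi> \<times> \<Phi>" for p
  proof -
    obtain \<phi> \<theta> where p: "p = (\<phi>, \<theta>)" "\<theta> \<in> \<Phi>"
      using \<open>p \<in> \<Phi> \<times> \<Phi>\<close> by blast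
    have \<theta>: "finite (\<theta> m)" "card (\<theta> m) \<le> 2 ^ m" for m
      using \<Phi> p(2) unfolding slaloms_def by blast+
    have "\<forall>\<^sub>\<infinity>n. k * card (F p n) \<le> n" for k
      unfolding MOST_nat_le
    proof (intro exI allI impI)
      fix n :: nat assume n: "4 ^ k \<le> n"
      then have "k \<le> M n"
        unfolding M_def by (rule le_floor_log_div_2)
      then have k: "k \<le> 2 ^ M n"
        using less_exp[of "M n"] by linarith
      have "n > 0"
        using n by (cases n) auto
      have "card (F p n) \<le> 2 ^ M n"
        using order_trans[OF card_image_le \<theta>(2)] \<theta>(1) by (simp add: F_def p)
      then have "k * card (F p n) \<le> 2 ^ M n * 2 ^ M n"
        using k by (intro mult_mono) simp_all
      also have "\<dots> = 4 ^ M n"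
        by (simp flip: power_mult_distrib)
      also have "\<dots> \<le> n"
        unfolding M_def using \<open>n > 0\<close> by (rule floor_log_div_2)
      finally show "k * card (F p n) \<le> n" .
    qed
    then show ?thesis
      using \<theta>(1) by (auto simp: narrow_slaloms_def F_def p)
  qed
  then have "F ` (\<Phi> \<times> \<Phi>) \<subseteq> narrow_slaloms"
    by blast
  moreover have "\<exists>\<psi>\<in>F ` (\<Phi> \<times> \<Phi>). \<forall>\<^sub>\<infinity>n. set_encode (A \<inter> {..<2 ^ Suc n}) \<in> \<psi> n" for A
  proof -
    \<comment> \<open>For \<open>n < 2\<close> the code of the initial segment need not lie below
      \<open>H2 n\<close>; the value \<open>0\<close> there changes nothing eventually.\<close>
    define f where "f n = (if n < 2 then 0 else set_encode (A \<inter> {..<2 ^ Suc n}))" for n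
    have "f n < H2 n" for n
    proof (cases "n < 2")
      case False
      then have "Suc n \<le> n ^ 4"
        using power4_ge[of n] by simp
      then have "(2 :: nat) ^ (2 ^ Suc n) \<le> 2 ^ (2 ^ (n ^ 4))"
        by (intro power_increasing) auto
      with set_encode_less[OF Int_lower2]
      have "set_encode (A \<inter> {..<2 ^ Suc n}) < 2 ^ (2 ^ (n ^ 4))"
        by (rule order.strict_trans2)
      then show ?thesis
        using False unfolding f_def H2_def by simp
    qed (simp add: f_def H2_def)
    then obtain \<phi> where \<phi>: "\<phi> \<in> \<Phi>" "\<forall>\<^sub>\<infinity>n. f n \<in> \<phi> n"
      using cov unfolding captured_def by blast
    \<comment> \<open>The index of the right guess; where \<open>\<phi> n\<close> misses
      \<open>f n\<close>, index \<open>0\<close> keeps the sequence of indices bounded.\<close>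
    have "\<exists>i<2 ^ n. f n \<in> \<phi> n \<longrightarrow> e \<phi> n i = f n" for n
    proof (cases "f n \<in> \<phi> n")
      case True
      then show ?thesis
        using subsetD[OF e[OF \<phi>(1)]] by (metis imageE lessThan_iff)
    qed (auto intro!: exI[of _ 0])
    then obtain i where i: "\<And>n. i n < 2 ^ n" "\<And>n. f n \<in> \<phi> n \<Longrightarrow> e \<phi> n (i n) = f n"
      by metis
    obtain \<theta> where \<theta>: "\<theta> \<in> \<Phi>" "\<forall>\<^sub>\<infinity>m. c m i \<in> \<theta> m"
      using cov c unfolding captured_def by force
    obtain n0 where n0: "\<And>n. n \<ge> n0 \<Longrightarrow> f n \<in> \<phi> n"
      using \<phi>(2) unfolding MOST_nat_le by blast
    obtain m0 where m0: "\<And>m. m \<ge> m0 \<Longrightarrow> c m i \<in> \<theta> m"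
      using \<theta>(2) unfolding MOST_nat_le by blast
    have "\<forall>\<^sub>\<infinity>n. set_encode (A \<inter> {..<2 ^ Suc n}) \<in> F (\<phi>, \<theta>) n"
      unfolding MOST_nat_le
    proof (intro exI allI impI)
      fix n assume n: "max n0 (4 ^ max m0 2) \<le> n"
      then have M: "max m0 2 \<le> M n"
        unfolding M_def by (intro le_floor_log_div_2) simp
      have "(4 :: nat) ^ 1 \<le> 4 ^ max m0 2"
        by (rule power_increasing) auto
      then have "n \<ge> 2"
        using n by simp
      then have "n < 4 ^ Suc (M n)"
        unfolding M_def by (intro floor_log_div_2) simp
      then have "d (M n) (c (M n) i) n = i n"
        using M i(1) by (intro d[rule_format]) auto
      then have "set_encode (A \<inter> {..<2 ^ Suc n}) = e \<phi> n (d (M n) (c (M n) i) n)"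
        using i(2)[OF n0[of n]] n \<open>n \<ge> 2\<close> by (simp add: f_def)
      then show "set_encode (A \<inter> {..<2 ^ Suc n}) \<in> F (\<phi>, \<theta>) n"
        using m0[of "M n"] M by (auto simp: F_def)
    qed
    then show ?thesis
      using \<phi>(1) \<theta>(1) by blast
  qed
  ultimately show ?thesis
    using card_of_image by blast
qed

section \<open>Metrics from slaloms\<close>

text \<open>Members of \<open>\<phi> n\<close> are read as codes of finite sets, which cut level
  \<open>n\<close> into atoms. Since \<open>floor_log 0 = 0\<close>, level \<open>0\<close> is
  \<open>{0, 1}\<close>.\<close>

definition slalom_equiv :: "(nat \<Rightarrow> nat set) \<Rightarrow> nat \<Rightarrow> nat \<Rightarrow> bool" where
  "slalom_equiv \<phi> x y \<longleftrightarrow> floor_log x = floor_log y \<and>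
     (\<forall>s\<in>\<phi> (floor_log x). x \<in> set_decode s \<longleftrightarrow> y \<in> set_decode s)"

text \<open>The term with \<open>max\<close> confines bounded sets to finitely many levels; at any
  scale, up to a finite set, only points of one atom are close.\<close>

definition slalom_metric :: "(nat \<Rightarrow> nat set) \<Rightarrow> nat \<Rightarrow> nat \<Rightarrow> real" where
  "slalom_metric \<phi> x y = (if x = y then 0 else if slalom_equiv \<phi> x y then 1
     else 1 + max (floor_log x) (floor_log y))"

lemma slalom_equiv_sym: "slalom_equiv \<phi> x y \<Longrightarrow> slalom_equiv \<phi> y x"
  by (auto simp: slalom_equiv_def)

lemma slalom_equiv_trans: "slalom_equiv \<phi> x y \<Longrightarrow> slalom_equiv \<phi> y z \<Longrightarrow> slalom_equiv \<phi> x z"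
  by (auto simp: slalom_equiv_def)

lemma finite_floor_log_le: "finite {x. floor_log x \<le> k}"
proof (rule finite_subset)
  show "{x. floor_log x \<le> k} \<subseteq> {..<2 ^ Suc k}"
  proof
    fix x assume "x \<in> {x. floor_log x \<le> k}"
    then have "(2 :: nat) ^ floor_log x \<le> 2 ^ k"
      by (intro power_increasing) auto
    then have "x < 2 * 2 ^ k"
      using floor_log_exp2_gt[of x] by linarith
    then show "x \<in> {..<2 ^ Suc k}"
      by simp
  qed
qed simp

lemma slalom_metric_le_imp:
  assumes "slalom_metric \<phi> x y \<le> R" "R \<le> floor_log x"
  shows "x = y \<or> slalom_equiv \<phi> x y"
  using assms by (auto simp: slalom_metric_def split: if_splits)

lemma Metric_space_slalom_metric: "Metric_space UNIV (slalom_metric \<phi>)"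
proof
  show "0 \<le> slalom_metric \<phi> x y" for x y
    by (simp add: slalom_metric_def)
  show "slalom_metric \<phi> x y = slalom_metric \<phi> y x" for x y
    using slalom_equiv_sym[of \<phi> x y] slalom_equiv_sym[of \<phi> y x]
    by (auto simp: slalom_metric_def max.commute)
  show "slalom_metric \<phi> x y = 0 \<longleftrightarrow> x = y" for x y
    by (simp add: slalom_metric_def add_nonneg_eq_0_iff)
  show "slalom_metric \<phi> x z \<le> slalom_metric \<phi> x y + slalom_metric \<phi> y z" for x y z
  proof -
    \<comment> \<open>In the last case one of the two steps leaves its atom. If the other stays in
      an atom, it preserves the level, so the long step already accounts for the distance from
      \<open>x\<close> to \<open>z\<close>.\<close>
    consider "x = y \<or> y = z" | "x \<noteq> y" "y \<noteq> z" "x = z \<or> slalom_equiv \<phi> x z"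
      | "x \<noteq> y" "y \<noteq> z" "x \<noteq> z" "\<not> slalom_equiv \<phi> x z" "\<not> slalom_equiv \<phi> x y \<or> \<not> slalom_equiv \<phi> y z"
      using slalom_equiv_trans[of \<phi> x y z] by blast
    then show ?thesis
    proof cases
      case 3
      have "slalom_equiv \<phi> x y \<Longrightarrow> floor_log x = floor_log y" "slalom_equiv \<phi> y z \<Longrightarrow> floor_log y = floor_log z"
        by (simp_all add: slalom_equiv_def)
      then show ?thesis
        using 3 by (cases "slalom_equiv \<phi> x y"; cases "slalom_equiv \<phi> y z") (simp_all add: slalom_metric_def)
    qed (auto simp: slalom_metric_def)
  qed
qed

lemma proper_metric_slalom_metric: "proper_metric (slalom_metric \<phi>)"
  unfolding proper_metric_def
proof (intro conjI allI impI)
  interpret Metric_space UNIV "slalom_metric \<phi>"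
    by (rule Metric_space_slalom_metric)
  fix A assume "mbounded A"
  then obtain x B where "A \<subseteq> mcball x B"
    unfolding mbounded_def by blast
  then have A: "slalom_metric \<phi> x y \<le> B" if "y \<in> A" for y
    using that by (auto simp: in_mcball)
  have "A \<subseteq> {y. floor_log y \<le> max (floor_log x) (nat \<lceil>B\<rceil>)}"
  proof
    fix y assume "y \<in> A"
    then show "y \<in> {y. floor_log y \<le> max (floor_log x) (nat \<lceil>B\<rceil>)}"
      using A[of y] by (auto simp: slalom_metric_def slalom_equiv_def split: if_splits) linarith+
  qed
  then show "finite A"
    using finite_floor_log_le finite_subset by blast
qed (rule Metric_space_slalom_metric)

lemma bounded_indicator: "bounded (range (indicat_real A))"
  by (auto simp: bounded_iff indicator_def intro!: exI[of _ 1])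

text \<open>Far out, close points lie in one atom, and the initial segment of \<open>A\<close> is
  one of the sets that cut out the atoms; so the indicator is constant on them.\<close>

lemma higson_function_slalom_metric_indicator:
  assumes "\<forall>\<^sub>\<infinity>n. set_encode (A \<inter> {..<2 ^ Suc n}) \<in> \<phi> n"
  shows "higson_function (slalom_metric \<phi>) (indicat_real A)"
  unfolding higson_function_def
proof (intro conjI allI impI)
  fix R \<epsilon> :: real assume "\<epsilon> > 0"
  obtain n0 where n0: "\<And>n. n \<ge> n0 \<Longrightarrow> set_encode (A \<inter> {..<2 ^ Suc n}) \<in> \<phi> n"
    using assms unfolding MOST_nat_le by blast
  have "indicat_real A x = indicator A y"
    if x: "x \<notin> {x. floor_log x \<le> max n0 (nat \<lceil>R\<rceil>)}" and d: "slalom_metric \<phi> x y \<le> R" for x y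
  proof -
    have "R \<le> floor_log x"
      using x by simp linarith
    then consider "x = y" | "slalom_equiv \<phi> x y"
      using slalom_metric_le_imp[OF d] by blast
    then show ?thesis
    proof cases
      case 2
      let ?n = "floor_log x"
      have "set_encode (A \<inter> {..<2 ^ Suc ?n}) \<in> \<phi> ?n"
        using x n0 by simp
      then have "x \<in> set_decode (set_encode (A \<inter> {..<2 ^ Suc ?n})) \<longleftrightarrow>
          y \<in> set_decode (set_encode (A \<inter> {..<2 ^ Suc ?n}))"
        using 2 unfolding slalom_equiv_def by blast
      then have "x \<in> A \<inter> {..<2 ^ Suc ?n} \<longleftrightarrow> y \<in> A \<inter> {..<2 ^ Suc ?n}"
        by (subst (asm) (1 2) set_encode_inverse) auto
      moreover have "x < 2 ^ Suc ?n" "y < 2 ^ Suc ?n"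
        using floor_log_exp2_gt[of x] floor_log_exp2_gt[of y] 2 by (auto simp: slalom_equiv_def)
      ultimately show ?thesis
        by (auto simp: indicator_def)
    qed simp
  qed
  then show "\<exists>K. finite K \<and> (\<forall>x y. x \<notin> K \<and> y \<notin> K \<and> slalom_metric \<phi> x y \<le> R \<longrightarrow>
      \<bar>indicat_real A x - indicat_real A y\<bar> < \<epsilon>)"
    using \<open>\<epsilon> > 0\<close> finite_floor_log_le
    by (intro exI[of _ "{x. floor_log x \<le> max n0 (nat \<lceil>R\<rceil>)}"]) auto
qed (rule bounded_indicator)

text \<open>Larger slaloms have finer atoms. Far out, points within \<open>R\<close> for
  \<open>\<psi>\<close> lie in one \<open>\<psi>\<close>-atom, hence in one
  \<open>\<phi>\<close>-atom; so testing \<open>f\<close> at scale \<open>1\<close> for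
  \<open>\<phi>\<close> suffices.\<close>

lemma higson_function_slalom_metric_mono:
  assumes sub: "\<forall>\<^sub>\<infinity>n. \<phi> n \<subseteq> \<psi> n" and f: "higson_function (slalom_metric \<phi>) f"
  shows "higson_function (slalom_metric \<psi>) f"
  unfolding higson_function_def
proof (intro conjI allI impI)
  fix R \<epsilon> :: real assume "\<epsilon> > 0"
  obtain n0 where n0: "\<And>n. n \<ge> n0 \<Longrightarrow> \<phi> n \<subseteq> \<psi> n"
    using sub unfolding MOST_nat_le by blast
  have "\<exists>K. finite K \<and> (\<forall>x y. x \<notin> K \<and> y \<notin> K \<and> slalom_metric \<phi> x y \<le> 1 \<longrightarrow> \<bar>f x - f y\<bar> < \<epsilon>)"
    using f \<open>\<epsilon> > 0\<close> unfolding higson_function_def by simp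
  then obtain K where K: "finite K"
      "\<And>x y. x \<notin> K \<Longrightarrow> y \<notin> K \<Longrightarrow> slalom_metric \<phi> x y \<le> 1 \<Longrightarrow> \<bar>f x - f y\<bar> < \<epsilon>"
    by blast
  define L where "L = {x. floor_log x \<le> max n0 (nat \<lceil>R\<rceil>)}"
  have "\<bar>f x - f y\<bar> < \<epsilon>"
    if xy: "x \<notin> K \<union> L" "y \<notin> K \<union> L" and d: "slalom_metric \<psi> x y \<le> R" for x y
  proof -
    have "R \<le> floor_log x" "floor_log x \<ge> n0"
      using xy(1) unfolding L_def by simp_all linarith+
    then have "x = y \<or> slalom_equiv \<phi> x y"
      using slalom_metric_le_imp[OF d] n0[of "floor_log x"] by (auto simp: slalom_equiv_def)
    then have "slalom_metric \<phi> x y \<le> 1"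
      by (auto simp: slalom_metric_def)
    then show ?thesis
      using K(2) xy by simp
  qed
  then show "\<exists>K. finite K \<and> (\<forall>x y. x \<notin> K \<and> y \<notin> K \<and> slalom_metric \<psi> x y \<le> R \<longrightarrow> \<bar>f x - f y\<bar> < \<epsilon>)"
    using K(1) finite_floor_log_le by (intro exI[of _ "K \<union> L"]) (auto simp: L_def)
qed (use f in \<open>simp add: higson_function_def\<close>)

text \<open>Pigeonhole: \<open>\<phi> n\<close> distinguishes at most \<open>2 ^ card (\<phi> n)\<close> of the \<open>2 ^ n\<close> points of level \<open>n\<close>.\<close>

lemma ex_slalom_equiv_pair:
  assumes "finite (\<phi> n)" "card (\<phi> n) < n"
  shows "\<exists>x y. x \<noteq> y \<and> slalom_equiv \<phi> x y \<and> floor_log x = n"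
proof -
  define F where "F x = {s \<in> \<phi> n. x \<in> set_decode s}" for x
  have "card (F ` {2 ^ n..<2 ^ Suc n}) \<le> card (Pow (\<phi> n))"
    using assms(1) by (intro card_mono) (auto simp: F_def)
  also have "\<dots> < 2 ^ n"
    using assms by (simp add: card_Pow)
  finally have "\<not> inj_on F {2 ^ n..<2 ^ Suc n}"
    by (intro pigeonhole) simp
  then obtain x y where xy: "x \<in> {2 ^ n..<2 ^ Suc n}" "y \<in> {2 ^ n..<2 ^ Suc n}" "x \<noteq> y" "F x = F y"
    unfolding inj_on_def by blast
  then have "floor_log x = n" "floor_log y = n"
    by (auto intro!: floor_log_eqI)
  moreover have "x \<in> set_decode s \<longleftrightarrow> y \<in> set_decode s" if "s \<in> \<phi> n" for s
    using xy(4) that unfolding F_def by blast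
  ultimately show ?thesis
    using xy(3) unfolding slalom_equiv_def by metis
qed

text \<open>On almost every level \<open>n\<close> take two points \<open>x n\<close>,
  \<open>y n\<close> of one atom, and let \<open>A\<close> consist of the points \<open>x n\<close>.
  These pairs have distance \<open>1\<close> and leave every finite set.\<close>

lemma ex_not_higson_function_slalom_metric:
  assumes "\<phi> \<in> narrow_slaloms"
  shows "\<exists>A. \<not> higson_function (slalom_metric \<phi>) (indicat_real A)"
proof -
  have "\<forall>\<^sub>\<infinity>n. 2 * card (\<phi> n) \<le> n"
    using assms unfolding narrow_slaloms_def by blast
  then obtain n0 where n0: "\<And>n. n \<ge> n0 \<Longrightarrow> 2 * card (\<phi> n) \<le> n"
    unfolding MOST_nat_le by blast
  \<comment> \<open>\<open>n > n0\<close> excludes \<open>n = 0\<close>, so that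
    \<open>2 * card (\<phi> n) \<le> n\<close> gives the strict inequality
    \<open>card (\<phi> n) < n\<close>.\<close>
  have "\<exists>x y. x \<noteq> y \<and> slalom_equiv \<phi> x y \<and> floor_log x = n" if "n > n0" for n
    using n0[of n] that assms by (intro ex_slalom_equiv_pair) (auto simp: narrow_slaloms_def)
  then obtain x y where xy: "\<And>n. n > n0 \<Longrightarrow> x n \<noteq> y n" "\<And>n. n > n0 \<Longrightarrow> slalom_equiv \<phi> (x n) (y n)"
      "\<And>n. n > n0 \<Longrightarrow> floor_log (x n) = n"
    by metis
  have y: "floor_log (y n) = n" if "n > n0" for n
    using xy(2,3)[OF that] by (simp add: slalom_equiv_def)
  define A where "A = x ` {n0<..}"
  have "\<not> higson_function (slalom_metric \<phi>) (indicat_real A)"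
  proof
    assume "higson_function (slalom_metric \<phi>) (indicat_real A)"
    then have "\<exists>K. finite K \<and> (\<forall>x y. x \<notin> K \<and> y \<notin> K \<and> slalom_metric \<phi> x y \<le> 1 \<longrightarrow>
        \<bar>indicat_real A x - indicator A y\<bar> < 1)"
      unfolding higson_function_def by simp
    then obtain K where K: "finite K"
        "\<And>x y. x \<notin> K \<Longrightarrow> y \<notin> K \<Longrightarrow> slalom_metric \<phi> x y \<le> 1 \<Longrightarrow> \<bar>indicat_real A x - indicator A y\<bar> < 1"
      by blast
    have "finite (floor_log ` K)"
      using K(1) by simp
    then obtain m where m: "\<forall>k\<in>floor_log ` K. k \<le> m"
      unfolding finite_nat_set_iff_bounded_le by blast
    let ?n = "Suc (max m n0)"
    have n: "?n > n0" by simp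
    have notin: "z \<notin> K" if "floor_log z = ?n" for z
    proof
      assume "z \<in> K"
      then have "floor_log z \<le> m" using m by blast
      then show False using that by simp
    qed
    have "x ?n \<notin> K" "y ?n \<notin> K"
      using notin xy(3)[OF n] y[OF n] by blast+
    moreover have "slalom_metric \<phi> (x ?n) (y ?n) \<le> 1"
      using xy(2)[OF n] by (simp add: slalom_metric_def)
    moreover have "x ?n \<in> A"
      unfolding A_def by simp
    moreover have "y ?n \<notin> A"
    proof
      assume "y ?n \<in> A"
      then obtain l where l: "l > n0" "y ?n = x l"
        unfolding A_def by blast
      then have "l = ?n"
        using xy(3)[OF l(1)] y[OF n] by simp
      then show False
        using xy(1)[OF n] l(2) by simp
    qed
    ultimately show False
      using K(2)[of "x ?n" "y ?n"] by simp
  qed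
  then show ?thesis by blast
qed

section \<open>Higson compactifications, \<beta>\<omega> and extension of bounded functions\<close>

lemma higson_le_higson_iff:
  "higson d \<preceq> higson d' \<longleftrightarrow> (\<forall>f. higson_function d f \<longrightarrow> higson_function d' f)"
proof
  show "\<forall>f. higson_function d f \<longrightarrow> higson_function d' f" if "higson d \<preceq> higson d'"
    using extends_to_mono[OF _ that] by (simp add: extends_to_higson_iff)
  show "higson d \<preceq> higson d'" if "\<forall>f. higson_function d f \<longrightarrow> higson_function d' f"
    unfolding higson_def[of d]
    by (rule cpt_of_le[OF higson_is_compactification]) (use that in \<open>simp add: extends_to_higson_iff\<close>)
qed

lemma higson_le_beta_omega: "higson d \<preceq> beta_omega"
  unfolding higson_def
proof (rule cpt_of_le[OF beta_omega_is_compactification])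
  show "extends_to f beta_omega" if "f \<in> {f. higson_function d f}" for f
    unfolding beta_omega_def using that by (intro extends_to_cpt_of) (simp add: higson_function_def)
qed

lemma beta_omega_le_iff:
  assumes "is_compactification t"
  shows "beta_omega \<preceq> t \<longleftrightarrow> (\<forall>f. bounded (range f) \<longrightarrow> extends_to f t)"
proof
  show "\<forall>f. bounded (range f) \<longrightarrow> extends_to f t" if "beta_omega \<preceq> t"
    using extends_to_mono[OF extends_to_cpt_of that[unfolded beta_omega_def]] by simp
  show "beta_omega \<preceq> t" if "\<forall>f. bounded (range f) \<longrightarrow> extends_to f t"
    unfolding beta_omega_def by (rule cpt_of_le[OF assms]) (use that in simp)
qed

lemma compactification_extension_in_closed:
  assumes t: "is_compactification t" and g: "continuous_map (fst t) euclideanreal g"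
    and S: "closed S" "\<And>n. g (snd t n) \<in> S" and p: "p \<in> topspace (fst t)"
  shows "g p \<in> S"
proof -
  have rng: "range (snd t) \<subseteq> topspace (fst t)"
    using t by (auto simp: is_compactification_def embedding_map_def homeomorphic_map_def quotient_map_def)
  have "closedin (fst t) {p \<in> topspace (fst t). g p \<in> S}"
    using g S(1) closedin_continuous_map_preimage by fastforce
  moreover have "range (snd t) \<subseteq> {p \<in> topspace (fst t). g p \<in> S}"
    using rng S(2) by auto
  ultimately have "fst t closure_of range (snd t) \<subseteq> {p \<in> topspace (fst t). g p \<in> S}"
    by (rule closure_of_minimal[rotated])
  then show ?thesis
    using t p unfolding is_compactification_def by auto
qed

text \<open>Partial sums of the binary expansion are dyadic truncations: each step appends the
  parity of the new integer part.\<close>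

lemma sum_binary_digits:
  fixes x :: real
  assumes "0 \<le> x" "x < 1"
  shows "(\<Sum>k<N. of_bool (odd \<lfloor>2 ^ Suc k * x\<rfloor>) / 2 ^ Suc k) = of_int \<lfloor>2 ^ N * x\<rfloor> / (2 ^ N :: real)"
proof (induction N)
  case 0
  have "\<lfloor>x\<rfloor> = 0" using assms by (simp add: floor_eq_iff)
  then show ?case by simp
next
  case (Suc N)
  let ?y = "\<lfloor>2 ^ Suc N * x\<rfloor>"
  have "\<lfloor>2 ^ N * x\<rfloor> = ?y div 2"
    using floor_divide_real_eq_div[of 2 "2 ^ Suc N * x"] by simp
  moreover have "real_of_int ?y = 2 * real_of_int (?y div 2) + of_bool (odd ?y)"
  proof -
    have "?y = 2 * (?y div 2) + of_bool (odd ?y)"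
      using div_mult_mod_eq[of ?y 2] by (simp only: mod_2_eq_odd mult.commute)
    then have "real_of_int ?y = real_of_int (2 * (?y div 2) + of_bool (odd ?y))"
      by (rule arg_cong)
    then show ?thesis
      unfolding of_int_add of_int_mult of_int_numeral of_int_of_bool .
  qed
  ultimately have "of_int ?y / (2 ^ Suc N :: real) = of_int \<lfloor>2 ^ N * x\<rfloor> / 2 ^ N + of_bool (odd ?y) / 2 ^ Suc N"
    by (simp only: add_divide_distrib) simp
  then show ?case
    by (simp only: Suc sum.lessThan_Suc)
qed

text \<open>After rescaling to \<open>[0, 1)\<close>, the binary digits of \<open>f\<close> are
  indicators. Their extensions, weighted by powers of \<open>1 / 2\<close>, form a uniformly
  convergent series, whose continuous sum extends the rescaled \<open>f\<close>.\<close>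

lemma extends_to_of_indicators:
  assumes t: "is_compactification t" and ind: "\<And>A. extends_to (indicat_real A) t"
    and f: "bounded (range f)"
  shows "extends_to f t"
proof -
  obtain B where B: "\<And>n. \<bar>f n\<bar> \<le> B"
    using f by (auto simp: bounded_iff)
  have Bpos: "B \<ge> 0"
    using B[of 0] by simp
  \<comment> \<open>The \<open>+ 1\<close> keeps the denominator positive when \<open>B = 0\<close>,
    and \<open>h n\<close> strictly below \<open>1\<close>.\<close>
  define h where "h n = (f n + B) / (2 * B + 1)" for n
  have h: "0 \<le> h n" "h n < 1" for n
    using B[of n] Bpos by (auto simp: h_def divide_simps abs_le_iff)
  define A where "A k = {n. odd \<lfloor>2 ^ Suc k * h n\<rfloor>}" for k
  have "\<forall>k. \<exists>g. continuous_map (fst t) euclideanreal g \<and> (\<forall>n. g (snd t n) = indicat_real (A k) n)"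
    using ind unfolding extends_to_def by blast
  then obtain g where g: "\<And>k. continuous_map (fst t) euclideanreal (g k)" "\<And>k n. g k (snd t n) = indicator (A k) n"
    by metis
  \<comment> \<open>Density of \<omega> carries the bounds over to the whole space, as the M-test
    requires.\<close>
  have g01: "g k p \<in> {0..1}" if "p \<in> topspace (fst t)" for k p
    by (rule compactification_extension_in_closed[OF t g(1) _ _ that]) (simp_all add: g(2) indicator_def)
  define G where "G p = (\<Sum>k. g k p / 2 ^ Suc k)" for p
  have g_le: "norm (g k p / 2 ^ Suc k) \<le> (1 / 2) ^ Suc k" if "p \<in> topspace (fst t)" for k p
    using g01[OF that, of k] by (simp add: power_divide divide_right_mono)
  have geom: "summable (\<lambda>k. (1 / 2) ^ Suc k :: real)"
    by (rule sums_summable[OF power_half_series])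
  have ulim: "uniform_limit (topspace (fst t)) (\<lambda>N p. \<Sum>k<N. g k p / 2 ^ Suc k) G sequentially"
    unfolding G_def using g_le geom by (rule Weierstrass_m_test)
  have Gcont: "continuous_map (fst t) euclideanreal G"
  proof -
    have "continuous_map (fst t) Met_TC.mtopology G"
    proof (rule Met_TC.continuous_map_uniform_limit[where F = sequentially])
      have "continuous_map (fst t) euclideanreal (\<lambda>p. \<Sum>k<N. g k p / 2 ^ Suc k)" for N
        using g(1) by (intro continuous_map_sum continuous_map_real_divide) auto
      then show "\<forall>\<^sub>F N in sequentially. continuous_map (fst t) Met_TC.mtopology (\<lambda>p. \<Sum>k<N. g k p / 2 ^ Suc k)"
        by (simp add: mtopology_is_euclidean)
      show "\<forall>\<^sub>F N in sequentially. \<forall>p\<in>topspace (fst t). G p \<in> UNIV \<and>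
          dist (\<Sum>k<N. g k p / 2 ^ Suc k) (G p) < \<epsilon>" if "0 < \<epsilon>" for \<epsilon>
        using uniform_limitD[OF ulim that] by simp
    qed simp
    then show ?thesis by (simp add: mtopology_is_euclidean)
  qed
  have Gh: "G (snd t n) = h n" for n
  proof -
    have "(\<Sum>k<N. g k (snd t n) / 2 ^ Suc k) = of_int \<lfloor>2 ^ N * h n\<rfloor> / 2 ^ N" for N
      unfolding sum_binary_digits[OF h, symmetric] g(2) A_def by (simp add: indicator_def of_bool_def)
    moreover have "(\<lambda>N. of_int \<lfloor>2 ^ N * h n\<rfloor> / 2 ^ N) \<longlonglongrightarrow> h n"
    proof (rule tendsto_sandwich)
      have "h n - (1 / 2) ^ N \<le> of_int \<lfloor>2 ^ N * h n\<rfloor> / 2 ^ N" for N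
      proof -
        have "2 ^ N * h n - 1 \<le> of_int \<lfloor>2 ^ N * h n\<rfloor>" by linarith
        then have "(2 ^ N * h n - 1) / 2 ^ N \<le> of_int \<lfloor>2 ^ N * h n\<rfloor> / 2 ^ N"
          by (rule divide_right_mono) simp
        then show ?thesis by (simp add: diff_divide_distrib power_divide)
      qed
      then show "\<forall>\<^sub>F N in sequentially. h n - (1 / 2) ^ N \<le> of_int \<lfloor>2 ^ N * h n\<rfloor> / 2 ^ N"
        by simp
      have "of_int \<lfloor>2 ^ N * h n\<rfloor> / 2 ^ N \<le> h n" for N
        by (simp add: divide_le_eq mult.commute)
      then show "\<forall>\<^sub>F N in sequentially. of_int \<lfloor>2 ^ N * h n\<rfloor> / 2 ^ N \<le> h n"
        by simp
      have "(\<lambda>N. h n - (1 / 2) ^ N) \<longlonglongrightarrow> h n - 0"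
        by (intro tendsto_diff tendsto_const LIMSEQ_power_zero) simp
      then show "(\<lambda>N. h n - (1 / 2) ^ N) \<longlonglongrightarrow> h n" by simp
    qed simp
    ultimately have "(\<lambda>k. g k (snd t n) / 2 ^ Suc k) sums h n"
      unfolding sums_def by simp
    then show ?thesis
      unfolding G_def by (simp add: sums_iff)
  qed
  have "continuous_map (fst t) euclideanreal (\<lambda>p. (2 * B + 1) * G p - B)"
    by (intro continuous_map_diff continuous_map_real_mult_left Gcont) auto
  moreover have "(2 * B + 1) * G (snd t n) - B = f n" for n
    using Bpos by (simp add: Gh h_def)
  ultimately show ?thesis
    unfolding extends_to_def by blast
qed

section \<open>The lower bound\<close>

lemma higson_chain_total:
  assumes "higson_chain D" "d \<in> D" "d' \<in> D"
  shows "(\<forall>f. higson_function d f \<longrightarrow> higson_function d' f) \<or> (\<forall>f. higson_function d' f \<longrightarrow> higson_function d f)"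
proof (cases "higson d = higson d'")
  case True
  then have "higson d \<preceq> higson d'"
    using higson_equiv_iff unfolding cpt_equiv_def by blast
  then show ?thesis
    unfolding higson_le_higson_iff by blast
next
  case False
  have "well_order_on (higson ` D) {(a, b). a \<in> higson ` D \<and> b \<in> higson ` D \<and> a \<preceq> b}"
    using assms(1) unfolding higson_chain_def by (elim conjE)
  then have "total_on (higson ` D) {(a, b). a \<in> higson ` D \<and> b \<in> higson ` D \<and> a \<preceq> b}"
    unfolding well_order_on_def linear_order_on_def by (elim conjE)
  then have "higson d \<preceq> higson d' \<or> higson d' \<preceq> higson d"
    using False assms(2,3) by (auto simp: total_on_def)
  then show ?thesis
    unfolding higson_le_higson_iff .
qed

lemma higson_chain_finite_upper_bound:
  assumes D: "higson_chain D" "D \<noteq> {}" and F: "finite F" "\<And>f. f \<in> F \<Longrightarrow> \<exists>d\<in>D. higson_function d f"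
  shows "\<exists>d\<in>D. \<forall>f\<in>F. higson_function d f"
  using F
proof (induction F)
  case empty
  then show ?case using D(2) by blast
next
  case (insert f F)
  have "\<exists>d\<in>D. \<forall>f\<in>F. higson_function d f"
    by (rule insert.IH) (simp add: insert.prems)
  then obtain d where d: "d \<in> D" "\<And>f. f \<in> F \<Longrightarrow> higson_function d f"
    by blast
  obtain d' where d': "d' \<in> D" "higson_function d' f"
    using insert.prems[of f] by auto
  from higson_chain_total[OF D(1) d(1) d'(1)] show ?case
  proof
    assume "\<forall>f. higson_function d f \<longrightarrow> higson_function d' f"
    then show ?thesis
      using d d' by (intro bexI[of _ d']) auto
  next
    assume "\<forall>f. higson_function d' f \<longrightarrow> higson_function d f"
    then show ?thesis
      using d d' by (intro bexI[of _ d]) auto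
  qed
qed

lemma not_higson_function_indicator:
  assumes "\<not> higson_function d (indicat_real A)"
  shows "\<exists>R>0. \<forall>K. finite K \<longrightarrow> (\<exists>x y. x \<notin> K \<and> y \<notin> K \<and> d x y \<le> R \<and> \<bar>indicat_real A x - indicat_real A y\<bar> = 1)"
proof -
  define Q where "Q R \<epsilon> \<longleftrightarrow> (\<exists>K. finite K \<and>
    (\<forall>x y. x \<notin> K \<and> y \<notin> K \<and> d x y \<le> R \<longrightarrow> \<bar>indicat_real A x - indicat_real A y\<bar> < \<epsilon>))" for R \<epsilon>
  have "\<not> (\<forall>R>0. \<forall>\<epsilon>>0. Q R \<epsilon>)"
    using assms by (simp only: higson_function_def bounded_indicator simp_thms Q_def not_False_eq_True)
  then obtain R \<epsilon> where R: "R > 0" "\<epsilon> > 0" and neg: "\<not> Q R \<epsilon>"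
    by (auto simp only: not_all not_imp)
  have "\<exists>x y. x \<notin> K \<and> y \<notin> K \<and> d x y \<le> R \<and> \<bar>indicat_real A x - indicat_real A y\<bar> = 1" if "finite K" for K
  proof -
    have "\<not> (\<forall>x y. x \<notin> K \<and> y \<notin> K \<and> d x y \<le> R \<longrightarrow> \<bar>indicat_real A x - indicat_real A y\<bar> < \<epsilon>)"
      using neg that unfolding Q_def by metis
    then obtain x y where xy: "x \<notin> K" "y \<notin> K" "d x y \<le> R" "\<not> \<bar>indicat_real A x - indicat_real A y\<bar> < \<epsilon>"
      by (auto simp only: not_all not_imp)
    then have "\<bar>indicat_real A x - indicat_real A y\<bar> = 1"
      using R(2) by (cases "x \<in> A"; cases "y \<in> A") auto
    with xy show ?thesis by blast
  qed
  with R(1) show ?thesis by blast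
qed

text \<open>Let \<open>F\<close> be the union of the function algebras. \<open>cpt_of F\<close>
  bounds the chain, so the indicator of \<open>A\<close> extends to it. If it were a Higson function
  for no \<open>d\<close>, any finitely many functions in \<open>F\<close>, being Higson functions
  for one \<open>d\<close>, would nearly agree on some pair split by \<open>A\<close>. Compactness
  then yields two points that agree in all coordinates but are separated by the extension.\<close>

lemma higson_chain_captures_indicator:
  assumes D: "higson_chain D"
  shows "\<exists>d\<in>D. higson_function d (indicat_real A)"
proof (rule ccontr)
  assume neg: "\<not> ?thesis"
  obtain s where sup: "is_cpt_sup (higson ` D) s" and beta: "beta_omega \<preceq> s"
    using D unfolding higson_chain_def cpt_equiv_def by blast
  have ext: "extends_to f t"
    if "is_compactification t" "\<And>d. d \<in> D \<Longrightarrow> higson d \<preceq> t" "bounded (range f)"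
    for t :: "((nat \<Rightarrow> real) \<Rightarrow> real) cpt" and f
  proof -
    have "s \<preceq> t"
      using sup that(1,2) unfolding is_cpt_sup_def by blast
    moreover have "extends_to f s"
      using beta sup that(3) beta_omega_le_iff unfolding is_cpt_sup_def by blast
    ultimately show ?thesis
      using extends_to_mono by blast
  qed
  show False
  proof (cases "D = {}")
    \<comment> \<open>Every compactification bounds the empty chain, so all bounded functions would
      extend to the Higson compactification of the empty slalom.\<close>
    case True
    have "(\<lambda>n. {}) \<in> narrow_slaloms"
      by (simp add: narrow_slaloms_def)
    then obtain B where "\<not> higson_function (slalom_metric (\<lambda>n. {})) (indicat_real B)"
      using ex_not_higson_function_slalom_metric by blast
    moreover have "extends_to (indicat_real B) (higson (slalom_metric (\<lambda>n. {})))"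
      using True by (intro ext higson_is_compactification bounded_indicator) auto
    ultimately show False
      by (simp add: extends_to_higson_iff)
  next
    case False
    define F where "F = {f. \<exists>d\<in>D. higson_function d f}"
    have single: "higson_function d (\<lambda>k. if k = n then 1 else 0)" for d n
    proof -
      have "bounded (range (\<lambda>k. if k = n then 1 else 0 :: real))"
        by (auto simp: bounded_iff intro!: exI[of _ 1])
      then show ?thesis
        by (auto simp: higson_function_def intro!: exI[of _ "{n}"])
    qed
    have comp: "is_compactification (cpt_of F)"
      using False single by (intro cpt_of_is_compactification) (auto simp: F_def higson_function_def)
    have "higson d \<preceq> cpt_of F" if "d \<in> D" for d
      unfolding higson_def by (intro cpt_of_le[OF comp] extends_to_cpt_of) (use that in \<open>auto simp: F_def\<close>)
    then have "extends_to (indicat_real A) (cpt_of F)"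
      by (intro ext comp bounded_indicator)
    then obtain g where g: "continuous_map (fst (cpt_of F)) euclideanreal g"
        "\<And>n. g (snd (cpt_of F) n) = indicator A n"
      unfolding extends_to_def by blast
    define T where "T = fst (cpt_of F)"
    define e where "e = eval_emb F"
    have snd: "snd (cpt_of F) = e"
      by (simp add: cpt_of_def e_def)
    have eT: "e n \<in> topspace T" for n
      using comp by (auto simp: is_compactification_def embedding_map_def homeomorphic_map_def
          quotient_map_def snd T_def)
    have proj: "continuous_map T euclideanreal (\<lambda>x. x h)" if "h \<in> F" for h
      using that unfolding T_def cpt_of_def
      by (auto intro: continuous_map_from_subtopology continuous_map_product_projection)
    \<comment> \<open>Pairs that \<open>h\<close> separates by at most \<open>\<epsilon>\<close>,
      although the extension \<open>g\<close> of the indicator separates them by at least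
      \<open>1\<close>.\<close>
    define Z where "Z = (\<lambda>(h, \<epsilon>). {z \<in> topspace (prod_topology T T).
        \<bar>fst z h - snd z h\<bar> \<in> {..\<epsilon>} \<and> \<bar>g (fst z) - g (snd z)\<bar> \<in> {1 :: real..}})"
    have closed: "closedin (prod_topology T T) (Z (h, \<epsilon>))" if "h \<in> F" for h \<epsilon>
    proof -
      have diff: "continuous_map (prod_topology T T) euclideanreal (\<lambda>z. \<bar>(u \<circ> fst) z - (u \<circ> snd) z\<bar>)"
        if "continuous_map T euclideanreal u" for u
        using that by (intro continuous_map_real_abs continuous_map_diff continuous_map_compose[OF _ that]
            continuous_map_fst continuous_map_snd)
      have "closedin (prod_topology T T) {z \<in> topspace (prod_topology T T). \<bar>((\<lambda>x. x h) \<circ> fst) z - ((\<lambda>x. x h) \<circ> snd) z\<bar> \<in> {..\<epsilon>}}"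
        by (rule closedin_continuous_map_preimage[OF diff[OF proj[OF that]]]) simp
      moreover have "closedin (prod_topology T T) {z \<in> topspace (prod_topology T T). \<bar>(g \<circ> fst) z - (g \<circ> snd) z\<bar> \<in> {1..}}"
        by (rule closedin_continuous_map_preimage[OF diff]) (use g(1) in \<open>simp_all add: T_def\<close>)
      ultimately have "closedin (prod_topology T T)
         ({z \<in> topspace (prod_topology T T). \<bar>((\<lambda>x. x h) \<circ> fst) z - ((\<lambda>x. x h) \<circ> snd) z\<bar> \<in> {..\<epsilon>}} \<inter>
          {z \<in> topspace (prod_topology T T). \<bar>(g \<circ> fst) z - (g \<circ> snd) z\<bar> \<in> {1..}})"
        by (rule closedin_Int)
      also have "\<dots> = Z (h, \<epsilon>)"
        unfolding Z_def by auto
      finally show ?thesis .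
    qed
    have fip: "\<Inter>(Z ` P) \<noteq> {}" if P: "finite P" "P \<subseteq> F \<times> {0<..}" for P
    proof -
      have "\<exists>d\<in>D. \<forall>f\<in>fst ` P. higson_function d f"
        by (rule higson_chain_finite_upper_bound[OF D False]) (use P in \<open>auto simp: F_def\<close>)
      then obtain d where d: "d \<in> D" "\<And>p. p \<in> P \<Longrightarrow> higson_function d (fst p)"
        by blast
      obtain R where R: "R > 0" and far: "\<And>K. finite K \<Longrightarrow>
          \<exists>x y. x \<notin> K \<and> y \<notin> K \<and> d x y \<le> R \<and> \<bar>indicat_real A x - indicat_real A y\<bar> = 1"
        using not_higson_function_indicator[of d A] neg d(1) by blast
      have "\<exists>K. finite K \<and> (\<forall>x y. x \<notin> K \<and> y \<notin> K \<and> d x y \<le> R \<longrightarrow> \<bar>fst p x - fst p y\<bar> < snd p)"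
        if p: "p \<in> P" for p
      proof -
        have "snd p > 0"
          using p P(2) by auto
        then show ?thesis
          using d(2)[OF p] R unfolding higson_function_def by metis
      qed
      then obtain K where K: "\<And>p. p \<in> P \<Longrightarrow> finite (K p)"
          "\<And>p x y. p \<in> P \<Longrightarrow> x \<notin> K p \<Longrightarrow> y \<notin> K p \<Longrightarrow> d x y \<le> R \<Longrightarrow> \<bar>fst p x - fst p y\<bar> < snd p"
        by metis
      obtain x y where xy: "x \<notin> \<Union>(K ` P)" "y \<notin> \<Union>(K ` P)" "d x y \<le> R"
          "\<bar>indicat_real A x - indicat_real A y\<bar> = 1"
        using far[of "\<Union>(K ` P)"] K(1) P(1) by blast
      have "(e x, e y) \<in> Z p" if p: "p \<in> P" for p
      proof -
        obtain h \<epsilon> where p_eq: "p = (h, \<epsilon>)" by (cases p)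
        have "h \<in> F" using p P(2) p_eq by auto
        then have "e x h = h x" "e y h = h y"
          by (simp_all add: e_def eval_emb_def)
        moreover have "\<bar>h x - h y\<bar> < \<epsilon>"
          using K(2)[OF p, of x y] xy p p_eq by auto
        ultimately show ?thesis
          using eT xy(4) g(2)[unfolded snd] by (simp add: p_eq Z_def)
      qed
      then show ?thesis by blast
    qed
    have "compact_space (prod_topology T T)"
      using comp by (simp add: compact_space_prod_topology is_compactification_def T_def)
    then have "\<Inter>(Z ` (F \<times> {0<..})) \<noteq> {}"
      unfolding compact_space_fip
    proof (elim allE[of _ "Z ` (F \<times> {0<..})"] mp, intro conjI ballI allI impI)
      show "closedin (prod_topology T T) C" if "C \<in> Z ` (F \<times> {0<..})" for C
        using that closed by auto
      fix \<F> assume "finite \<F> \<and> \<F> \<subseteq> Z ` (F \<times> {0<..})"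
      then obtain P where "finite P" "P \<subseteq> F \<times> {0<..}" "\<F> = Z ` P"
        using finite_subset_image[of \<F> Z "F \<times> {0<..}"] by metis
      then show "\<Inter>\<F> \<noteq> {}"
        using fip by simp
    qed
    then obtain z where z: "\<And>i. i \<in> F \<times> {0<..} \<Longrightarrow> z \<in> Z i"
      by auto
    define p q where "p = fst z" and "q = snd z"
    have pq: "(p, q) \<in> Z (h, \<epsilon>)" if "h \<in> F" "\<epsilon> > 0" for h \<epsilon>
      using z[of "(h, \<epsilon>)"] that by (simp add: p_def q_def)
    obtain h0 where h0: "h0 \<in> F"
      using False single unfolding F_def by blast
    have pqT: "p \<in> topspace T" "q \<in> topspace T" and g1: "\<bar>g p - g q\<bar> \<ge> 1"
      using pq[OF h0, of 1] by (auto simp: Z_def)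
    have "p h = q h" for h
    proof (cases "h \<in> F")
      case True
      have "\<bar>p h - q h\<bar> \<le> \<epsilon>" if "\<epsilon> > 0" for \<epsilon>
        using pq[OF True that] by (simp add: Z_def)
      then show ?thesis
        by (metis abs_le_zero_iff dense_ge right_minus_eq)
    next
      \<comment> \<open>Coordinates outside \<open>F\<close> are undefined at every point and hence
        agree.\<close>
      case False
      then show ?thesis
        using pqT unfolding T_def cpt_of_def by (auto simp: PiE_def extensional_def)
    qed
    then have "p = q" by blast
    then show False
      using g1 by simp
  qed
qed

section \<open>Disjoint pairs of close points\<close>

definition pair_points :: "nat \<times> nat \<Rightarrow> nat set" where
  "pair_points p = {fst p, snd p}"

lemma ex_disjoint_pairs:
  assumes "\<And>K. finite K \<Longrightarrow> \<exists>x y. x \<notin> K \<and> y \<notin> K \<and> P x y"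
  shows "\<exists>p :: nat \<Rightarrow> nat \<times> nat. \<forall>i. P (fst (p i)) (snd (p i)) \<and> (\<forall>j<i. pair_points (p j) \<inter> pair_points (p i) = {})"
proof (rule dependent_wf_choice[where R = less_than])
  fix x and p :: "nat \<Rightarrow> nat \<times> nat"
  have "finite (\<Union>j<x. pair_points (p j))"
    by (simp add: pair_points_def)
  then show "\<exists>r. P (fst r) (snd r) \<and> (\<forall>j<x. pair_points (p j) \<inter> pair_points r = {})"
    using assms[of "\<Union>j<x. pair_points (p j)"] by (auto simp: pair_points_def)
qed auto

text \<open>A point of \<open>K\<close> lies in at most one of the disjoint pairs, so
  \<open>K\<close> meets at most \<open>card K\<close> of them.\<close>

lemma ex_pair_avoiding:
  assumes K: "finite K" "card K < length l"
    and disj: "\<And>i j. i < length l \<Longrightarrow> j < i \<Longrightarrow> pair_points (l ! j) \<inter> pair_points (l ! i) = {}"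
  shows "\<exists>r\<in>set l. pair_points r \<inter> K = {}"
proof (rule ccontr)
  assume "\<not> ?thesis"
  then have "\<exists>c. c \<in> pair_points (l ! i) \<inter> K" if "i < length l" for i
    using that nth_mem by blast
  then obtain c where c: "\<And>i. i < length l \<Longrightarrow> c i \<in> pair_points (l ! i) \<inter> K"
    by metis
  have "inj_on c {..<length l}"
  proof (rule linorder_inj_onI')
    fix j i assume "i \<in> {..<length l}" "j \<in> {..<length l}" "j < i"
    then show "c j \<noteq> c i"
      using disj[of i j] c[of i] c[of j] by auto
  qed
  then have "length l \<le> card K"
    using c K(1) card_inj_on_le[of c "{..<length l}" K] by auto
  then show False using K(2) by simp
qed

text \<open>Greedy choice. The lists with index at most \<open>k\<close> number at most
  \<open>Suc k * 4 ^ k\<close>, so earlier choices occupy at most twice as many points; a list with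
  one more pair than that has a free pair.\<close>

lemma ex_disjoint_representatives:
  fixes S :: "nat \<Rightarrow> (nat \<times> nat) list set"
  assumes S: "\<And>k. finite (S k)" "\<And>k. card (S k) \<le> 4 ^ k"
    and len: "\<And>k l. l \<in> S k \<Longrightarrow> length l = Suc (2 * (Suc k * 4 ^ k))"
    and disj: "\<And>k l i j. l \<in> S k \<Longrightarrow> i < length l \<Longrightarrow> j < i \<Longrightarrow> pair_points (l ! j) \<inter> pair_points (l ! i) = {}"
  shows "\<exists>q. \<forall>i\<in>Sigma UNIV S. q i \<in> set (snd i) \<and> (\<forall>j\<in>Sigma UNIV S. j \<noteq> i \<longrightarrow> pair_points (q j) \<inter> pair_points (q i) = {})"
proof -
  \<comment> \<open>Lexicographic, by \<open>k\<close> and then by a code of the list: total and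
    well-founded, and predecessors have first component at most \<open>k\<close>.\<close>
  define r where "r = inv_image (less_than <*lex*> less_than) (\<lambda>(k :: nat, l :: (nat \<times> nat) list). (k, to_nat l))"
  have "wf r"
    unfolding r_def by (intro wf_inv_image wf_lex_prod wf_less_than)
  have r_le: "fst j \<le> fst i" if "(j, i) \<in> r" for i j
    using that by (cases i; cases j) (auto simp: r_def)
  have r_total: "(j, i) \<in> r \<or> (i, j) \<in> r" if "i \<noteq> j" for i j
    using that by (cases i; cases j) (auto simp: r_def not_less_iff_gr_or_eq inj_eq[OF inj_to_nat])
  have "\<exists>q. \<forall>i. i \<in> Sigma UNIV S \<longrightarrow> q i \<in> set (snd i) \<and>
      (\<forall>j\<in>Sigma UNIV S. (j, i) \<in> r \<longrightarrow> pair_points (q j) \<inter> pair_points (q i) = {})"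
  proof (rule dependent_wf_choice[OF \<open>wf r\<close>])
    fix i :: "nat \<times> (nat \<times> nat) list" and q :: "nat \<times> (nat \<times> nat) list \<Rightarrow> nat \<times> nat"
    obtain k l where i: "i = (k, l)" by (cases i)
    show "\<exists>p. i \<in> Sigma UNIV S \<longrightarrow> p \<in> set (snd i) \<and>
      (\<forall>j\<in>Sigma UNIV S. (j, i) \<in> r \<longrightarrow> pair_points (q j) \<inter> pair_points p = {})"
    proof (cases "l \<in> S k")
      case True
      define J where "J = Sigma {..k} S"
      have J: "j \<in> J" if "j \<in> Sigma UNIV S" "(j, i) \<in> r" for j
        using that r_le[of j i] by (auto simp: J_def i)
      have finJ: "finite J"
        unfolding J_def using S(1) by auto
      have "card J = (\<Sum>m\<le>k. card (S m))"
        unfolding J_def using S(1) by (subst card_SigmaI) auto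
      also have "\<dots> \<le> (\<Sum>m\<le>k. 4 ^ k)"
        by (intro sum_mono order_trans[OF S(2)] power_increasing) auto
      also have "\<dots> = Suc k * 4 ^ k"
        by simp
      finally have cardJ: "card J \<le> Suc k * 4 ^ k" .
      let ?K = "\<Union>j\<in>J. pair_points (q j)"
      have "card ?K \<le> (\<Sum>j\<in>J. card (pair_points (q j)))"
        by (rule card_UN_le[OF finJ])
      also have "\<dots> \<le> (\<Sum>j\<in>J. 2)"
        by (rule sum_mono) (simp add: pair_points_def card_insert_if)
      also have "\<dots> < length l"
        using cardJ len[OF True] by simp
      finally have "\<exists>p\<in>set l. pair_points p \<inter> ?K = {}"
        using finJ disj[OF True] by (intro ex_pair_avoiding) (auto simp: pair_points_def)
      then obtain p where p: "p \<in> set l" "pair_points p \<inter> ?K = {}"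
        by blast
      have "pair_points (q j) \<inter> pair_points p = {}" if "j \<in> Sigma UNIV S" "(j, i) \<in> r" for j
        using J[OF that] p(2) by blast
      then show ?thesis
        using p(1) by (intro exI[of _ p]) (simp add: i)
    qed (simp add: i)
  qed auto
  then show ?thesis
    using r_total by (metis Int_commute)
qed


text \<open>If for every \<open>R\<close> distinct points outside some finite set were more than
  \<open>R\<close> apart, every bounded function would be a Higson function.\<close>

lemma ex_close_pairs:
  assumes "\<not> higson d \<simeq> beta_omega"
  shows "\<exists>R>0. \<forall>K. finite K \<longrightarrow> (\<exists>x y. x \<notin> K \<and> y \<notin> K \<and> x \<noteq> y \<and> d x y \<le> R)"
proof (rule ccontr)
  assume neg: "\<not> ?thesis"
  have "higson_function d f" if "bounded (range f)" for f
    unfolding higson_function_def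
  proof (intro conjI allI impI)
    fix R \<epsilon> :: real assume "R > 0" "\<epsilon> > 0"
    then obtain K where K: "finite K" "\<And>x y. x \<notin> K \<Longrightarrow> y \<notin> K \<Longrightarrow> d x y \<le> R \<Longrightarrow> x = y"
      using neg by metis
    have "\<bar>f x - f y\<bar> < \<epsilon>" if "x \<notin> K" "y \<notin> K" "d x y \<le> R" for x y
      using K(2)[OF that] \<open>\<epsilon> > 0\<close> by simp
    then show "\<exists>K. finite K \<and> (\<forall>x y. x \<notin> K \<and> y \<notin> K \<and> d x y \<le> R \<longrightarrow> \<bar>f x - f y\<bar> < \<epsilon>)"
      using K(1) by metis
  qed fact
  then have "beta_omega \<preceq> higson d"
    by (simp add: beta_omega_le_iff[OF higson_is_compactification] extends_to_higson_iff)
  then show False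
    using assms higson_le_beta_omega unfolding cpt_equiv_def by blast
qed

text \<open>If \<open>D\<close> has fewer than \<open>add_null\<close> members, one slalom captures, for every \<open>d \<in> D\<close>, long lists of
  disjoint pairs at bounded \<open>d\<close>-distance. Splitting one pair of every list in the slalom, all these pairs being
  disjoint, yields a set whose indicator is a Higson function for no \<open>d \<in> D\<close>.\<close>

lemma ex_indicator_not_higson:
  assumes card: "|D| <o add_null" and D: "\<And>d. d \<in> D \<Longrightarrow> \<not> higson d \<simeq> beta_omega"
  shows "\<exists>A. \<forall>d\<in>D. \<not> higson_function d (indicat_real A)"
proof -
  have "\<exists>R (p :: nat \<Rightarrow> nat \<times> nat). R > 0 \<and> (\<forall>i. fst (p i) \<noteq> snd (p i) \<and> d (fst (p i)) (snd (p i)) \<le> R \<and>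
      (\<forall>j<i. pair_points (p j) \<inter> pair_points (p i) = {}))" if d: "d \<in> D" for d
  proof -
    obtain R where R: "R > 0" "\<And>K. finite K \<Longrightarrow> \<exists>x y. x \<notin> K \<and> y \<notin> K \<and> x \<noteq> y \<and> d x y \<le> R"
      using ex_close_pairs[OF D[OF d]] by metis
    then obtain p :: "nat \<Rightarrow> nat \<times> nat" where "\<forall>i. (fst (p i) \<noteq> snd (p i) \<and> d (fst (p i)) (snd (p i)) \<le> R) \<and>
        (\<forall>j<i. pair_points (p j) \<inter> pair_points (p i) = {})"
      using ex_disjoint_pairs[of "\<lambda>x y. x \<noteq> y \<and> d x y \<le> R"] by blast
    then show ?thesis
      using R(1) by (intro exI[of _ R] exI[of _ p]) simp
  qed
  then obtain R :: "(nat \<Rightarrow> nat \<Rightarrow> real) \<Rightarrow> real" and p :: "(nat \<Rightarrow> nat \<Rightarrow> real) \<Rightarrow> nat \<Rightarrow> nat \<times> nat"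
    where R: "\<And>d. d \<in> D \<Longrightarrow> R d > 0"
      and p: "\<And>d i. d \<in> D \<Longrightarrow> fst (p d i) \<noteq> snd (p d i)"
        "\<And>d i. d \<in> D \<Longrightarrow> d (fst (p d i)) (snd (p d i)) \<le> R d"
        "\<And>d i j. d \<in> D \<Longrightarrow> j < i \<Longrightarrow> pair_points (p d j) \<inter> pair_points (p d i) = {}"
    by metis
  \<comment> \<open>The length that guarantees disjoint representatives for up to
    \<open>4 ^ k\<close> lists at each \<open>k\<close>.\<close>
  define N where "N k = Suc (2 * (Suc k * 4 ^ k))" for k :: nat
  define c where "c d k = map (p d) [0..<N k]" for d k
  from ex_slalom_capturing[OF ordLeq_ordLess_trans[OF card_of_image[of c D] card]]
  obtain S0 where S0: "\<And>k. finite (S0 k)" "\<And>k. card (S0 k) \<le> 4 ^ k" "\<forall>f\<in>c ` D. \<forall>\<^sub>\<infinity>k. f k \<in> S0 k"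
    by blast
  \<comment> \<open>Guessed lists of the wrong shape are dropped; every captured
    \<open>c d k\<close> has the right one and survives.\<close>
  define S where "S k = {l \<in> S0 k. length l = N k \<and> (\<forall>r\<in>set l. fst r \<noteq> snd r) \<and>
      (\<forall>i<length l. \<forall>j<i. pair_points (l ! j) \<inter> pair_points (l ! i) = {})}" for k
  have "\<exists>q. \<forall>i\<in>Sigma UNIV S. q i \<in> set (snd i) \<and> (\<forall>j\<in>Sigma UNIV S. j \<noteq> i \<longrightarrow> pair_points (q j) \<inter> pair_points (q i) = {})"
  proof (rule ex_disjoint_representatives)
    have sub: "S k \<subseteq> S0 k" for k by (auto simp: S_def)
    show "finite (S k)" "card (S k) \<le> 4 ^ k" for k
      using finite_subset[OF sub S0(1)] order_trans[OF card_mono[OF S0(1) sub] S0(2)] .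
  qed (auto simp: S_def N_def)
  then obtain q where q: "\<And>i. i \<in> Sigma UNIV S \<Longrightarrow> q i \<in> set (snd i)"
      "\<And>i j. i \<in> Sigma UNIV S \<Longrightarrow> j \<in> Sigma UNIV S \<Longrightarrow> j \<noteq> i \<Longrightarrow> pair_points (q j) \<inter> pair_points (q i) = {}"
    by metis
  \<comment> \<open>The first point of every chosen pair and, by disjointness, never the
    second.\<close>
  define A where "A = (\<lambda>i. fst (q i)) ` Sigma UNIV S"
  have qA: "fst (q i) \<in> A" "snd (q i) \<notin> A" if i: "i \<in> Sigma UNIV S" for i
  proof -
    show "fst (q i) \<in> A"
      using i unfolding A_def by blast
    show "snd (q i) \<notin> A"
    proof
      assume "snd (q i) \<in> A"
      then obtain j where j: "j \<in> Sigma UNIV S" "snd (q i) = fst (q j)"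
        unfolding A_def by blast
      have "fst (q i) \<noteq> snd (q i)"
        using q(1)[OF i] i by (auto simp: S_def)
      then have "j \<noteq> i" using j(2) by auto
      then show False
        using q(2)[OF i j(1)] j(2) by (auto simp: pair_points_def)
    qed
  qed
  have "\<not> higson_function d (indicat_real A)" if d: "d \<in> D" for d
  proof
    assume "higson_function d (indicat_real A)"
    then have "\<exists>K. finite K \<and> (\<forall>x y. x \<notin> K \<and> y \<notin> K \<and> d x y \<le> R d \<longrightarrow> \<bar>indicat_real A x - indicat_real A y\<bar> < 1)"
      using R[OF d] unfolding higson_function_def by simp
    then obtain K where K: "finite K"
        "\<And>x y. x \<notin> K \<Longrightarrow> y \<notin> K \<Longrightarrow> d x y \<le> R d \<Longrightarrow> \<bar>indicat_real A x - indicat_real A y\<bar> < 1"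
      by blast
    obtain k0 where "\<And>k. k \<ge> k0 \<Longrightarrow> c d k \<in> S0 k"
      using S0(3) d unfolding MOST_nat_le by blast
    then have cS: "(k, c d k) \<in> Sigma UNIV S" if "k \<ge> k0" for k
      using that p(1,3)[OF d] by (auto simp: S_def c_def)
    define u where "u k = q (k, c d k)" for k
    have "\<exists>x. x \<in> pair_points (u k) \<inter> K" if k: "k \<ge> k0" for k
    proof (rule ccontr)
      assume "\<not> ?thesis"
      then have "fst (u k) \<notin> K" "snd (u k) \<notin> K"
        by (auto simp: pair_points_def)
      moreover have "d (fst (u k)) (snd (u k)) \<le> R d"
        using q(1)[OF cS[OF k]] p(2)[OF d] by (auto simp: c_def u_def)
      ultimately show False
        using K(2)[of "fst (u k)" "snd (u k)"] qA[OF cS[OF k]] by (simp add: u_def)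
    qed
    then obtain x where x: "\<And>k. k \<ge> k0 \<Longrightarrow> x k \<in> pair_points (u k) \<inter> K"
      by metis
    \<comment> \<open>The pairs \<open>u k\<close> are disjoint, so the finite \<open>K\<close>
      would contain infinitely many points \<open>x k\<close>.\<close>
    have "inj_on x {k0..}"
    proof (rule linorder_inj_onI')
      fix j k assume jk: "j \<in> {k0..}" "k \<in> {k0..}" "j < k"
      then have "pair_points (u j) \<inter> pair_points (u k) = {}"
        unfolding u_def by (intro q(2) cS) auto
      then show "x j \<noteq> x k"
        using x[of j] x[of k] jk by auto
    qed
    moreover have "finite (x ` {k0..})"
      using x K(1) by (intro finite_subset[OF _ K(1)]) auto
    ultimately show False
      using finite_imageD infinite_Ici by blast
  qed
  then show ?thesis by blast
qed

lemma add_null_le_higson_chain: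
  assumes "higson_chain D"
  shows "add_null \<le>o |D|"
proof (rule ccontr)
  assume "\<not> add_null \<le>o |D|"
  then have "|D| <o add_null"
    using not_ordLeq_iff_ordLess[OF card_of_Well_order card_order_on_well_order_on[OF Card_order_add_null]]
    by blast
  then obtain A where "\<forall>d\<in>D. \<not> higson_function d (indicat_real A)"
    using ex_indicator_not_higson assms unfolding higson_chain_def by blast
  then show False
    using higson_chain_captures_indicator[OF assms, of A] by blast
qed

section \<open>The chain\<close>

lemma cpt_le_refl: "a \<preceq> a"
  unfolding cpt_le_def by (intro exI[of _ id]) auto

lemma cpt_le_trans:
  assumes "a \<preceq> b" "b \<preceq> c"
  shows "a \<preceq> c"
proof -
  obtain g h where
    g: "continuous_map (fst b) (fst a) g" "g ` topspace (fst b) = topspace (fst a)" "\<And>n. g (snd b n) = snd a n"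
    and h: "continuous_map (fst c) (fst b) h" "h ` topspace (fst c) = topspace (fst b)" "\<And>n. h (snd c n) = snd b n"
    using assms unfolding cpt_le_def by metis
  have "continuous_map (fst c) (fst a) (g \<circ> h)"
    using h(1) g(1) by (rule continuous_map_compose)
  moreover have "(g \<circ> h) ` topspace (fst c) = topspace (fst a)"
    by (simp only: image_comp[symmetric] h(2) g(2))
  moreover have "\<forall>n. (g \<circ> h) (snd c n) = snd a n"
    by (simp add: g(3) h(3))
  ultimately show ?thesis
    unfolding cpt_le_def by blast
qed

text \<open>The image of a well-order under a monotone map that need not be injective. Antisymmetry
  holds since equivalent Higson compactifications are equal; least elements come from least
  indices.\<close>

lemma well_order_on_higson_image:
  assumes \<kappa>: "Well_order \<kappa>" and mono: "\<And>\<alpha> \<beta>. (\<alpha>, \<beta>) \<in> \<kappa> \<Longrightarrow> higson (d \<alpha>) \<preceq> higson (d \<beta>)"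
  shows "well_order_on (higson ` d ` Field \<kappa>)
    {(a, b). a \<in> higson ` d ` Field \<kappa> \<and> b \<in> higson ` d ` Field \<kappa> \<and> a \<preceq> b}"
proof -
  define H where "H = higson ` d ` Field \<kappa>"
  define r where "r = {(a, b). a \<in> H \<and> b \<in> H \<and> a \<preceq> b}"
  have r_iff: "(a, b) \<in> r \<longleftrightarrow> a \<in> H \<and> b \<in> H \<and> a \<preceq> b" for a b
    by (simp add: r_def)
  have H: "\<exists>\<alpha>\<in>Field \<kappa>. a = higson (d \<alpha>)" if "a \<in> H" for a
    using that by (auto simp only: H_def)
  have total: "(\<alpha>, \<beta>) \<in> \<kappa> \<or> (\<beta>, \<alpha>) \<in> \<kappa>" if "\<alpha> \<in> Field \<kappa>" "\<beta> \<in> Field \<kappa>" "\<alpha> \<noteq> \<beta>" for \<alpha> \<beta>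
    using \<kappa> that by (auto simp: order_on_defs well_order_on_def total_on_def)
  have antisym: "a = b" if ab: "a \<in> H" "b \<in> H" "a \<preceq> b" "b \<preceq> a" for a b
  proof -
    obtain \<alpha> \<beta> where \<alpha>: "a = higson (d \<alpha>)" and \<beta>: "b = higson (d \<beta>)"
      using H[OF ab(1)] H[OF ab(2)] by metis
    then have "higson (d \<alpha>) \<simeq> higson (d \<beta>)"
      using ab(3,4) by (simp add: cpt_equiv_def)
    then show ?thesis
      using \<alpha> \<beta> by (simp add: higson_equiv_iff)
  qed
  have "r \<subseteq> H \<times> H"
    by (auto simp only: r_def)
  moreover have "refl_on H r"
    by (simp add: refl_on_def r_iff cpt_le_refl)
  moreover have "trans r"
    using cpt_le_trans by (intro transI) (simp add: r_iff, blast)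
  moreover have "antisym r"
    using antisym by (intro antisymI) (simp add: r_iff)
  moreover have "total_on H r"
    unfolding total_on_def
  proof (intro ballI impI)
    fix a b assume ab: "a \<in> H" "b \<in> H" "a \<noteq> b"
    obtain \<alpha> where \<alpha>: "\<alpha> \<in> Field \<kappa>" "a = higson (d \<alpha>)"
      using H[OF ab(1)] by (elim bexE)
    obtain \<beta> where \<beta>: "\<beta> \<in> Field \<kappa>" "b = higson (d \<beta>)"
      using H[OF ab(2)] by (elim bexE)
    have "\<alpha> \<noteq> \<beta>"
      using ab(3) \<alpha>(2) \<beta>(2) by auto
    then have "a \<preceq> b \<or> b \<preceq> a"
      using total[OF \<alpha>(1) \<beta>(1)] mono[of \<alpha> \<beta>] mono[of \<beta> \<alpha>] \<alpha>(2) \<beta>(2) by auto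
    then show "(a, b) \<in> r \<or> (b, a) \<in> r"
      using ab by (simp add: r_iff)
  qed
  moreover have "wf (r - Id)"
  proof (rule wfI_min)
    fix x and Q :: "((nat \<Rightarrow> real) \<Rightarrow> real) cpt set"
    assume x: "x \<in> Q"
    show "\<exists>z\<in>Q. \<forall>y. (y, z) \<in> r - Id \<longrightarrow> y \<notin> Q"
    proof (cases "x \<in> H")
      case True
      define B where "B = {\<alpha> \<in> Field \<kappa>. higson (d \<alpha>) \<in> Q}"
      have "\<exists>\<alpha>. \<alpha> \<in> B"
        using H[OF True] x by (auto simp only: B_def)
      moreover have "wf (\<kappa> - Id)"
        using \<kappa> by (simp add: well_order_on_def)
      ultimately obtain \<alpha> where \<alpha>: "\<alpha> \<in> B" "\<And>\<beta>. (\<beta>, \<alpha>) \<in> \<kappa> - Id \<Longrightarrow> \<beta> \<notin> B"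
        by (meson wfE_min)
      have "y \<notin> Q" if y: "(y, higson (d \<alpha>)) \<in> r - Id" for y
      proof
        assume "y \<in> Q"
        have yH: "y \<in> H" "higson (d \<alpha>) \<in> H" "y \<preceq> higson (d \<alpha>)" "y \<noteq> higson (d \<alpha>)"
          using y by (simp_all add: r_iff)
        obtain \<beta> where \<beta>: "\<beta> \<in> Field \<kappa>" "y = higson (d \<beta>)"
          using H[OF yH(1)] by (elim bexE)
        have "\<beta> \<in> B"
          using \<beta> \<open>y \<in> Q\<close> by (simp add: B_def)
        moreover have "\<beta> \<noteq> \<alpha>"
          using yH(4) \<beta>(2) by auto
        ultimately have "(\<alpha>, \<beta>) \<in> \<kappa>"
          using \<alpha> total[of \<alpha> \<beta>] by (auto simp: B_def)
        then have "y = higson (d \<alpha>)"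
          using mono[of \<alpha> \<beta>] \<beta>(2) by (intro antisym yH) simp
        then show False using yH(4) by simp
      qed
      then show ?thesis
        using \<alpha>(1) by (intro bexI[of _ "higson (d \<alpha>)"]) (simp_all add: B_def)
    next
      case False
      then show ?thesis
        using x by (intro bexI[of _ x]) (simp_all add: r_iff)
    qed
  qed
  ultimately have "well_order_on H r"
    unfolding well_order_on_def order_on_defs by simp
  then show ?thesis
    unfolding r_def H_def .
qed

text \<open>The minimum is attained because a covering family exists: the singletons
  \<open>{f n}\<close> form a member of \<open>slaloms_plus\<close>, as \<open>1 / 2 ^ n\<close>
  tends to \<open>0\<close>.\<close>

lemma l_prime_properties:
  obtains \<Phi> where "\<Phi> \<subseteq> slaloms_plus" "\<forall>f \<in> (\<Pi> n\<in>UNIV. {..<h n}). \<exists>\<phi>\<in>\<Phi>. f \<sqsubseteq>\<^sub>s \<phi>" "l_prime h = |\<Phi>|"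
proof -
  have "(\<lambda>n. {f n}) \<in> slaloms_plus" for f :: "nat \<Rightarrow> nat"
    using LIMSEQ_power_zero[of "1 / 2 :: real"] by (simp add: slaloms_plus_def slaloms_def power_divide)
  moreover have "f \<sqsubseteq>\<^sub>s (\<lambda>n. {f n})" for f
    by (simp add: captured_def)
  ultimately have "slaloms_plus \<subseteq> slaloms_plus \<and>
      (\<forall>f \<in> (\<Pi> n\<in>UNIV. {..<h n}). \<exists>\<phi>\<in>slaloms_plus. f \<sqsubseteq>\<^sub>s \<phi>)"
    by blast
  from min_card_properties[of "\<lambda>\<Phi>. \<Phi> \<subseteq> slaloms_plus \<and>
     (\<forall>f \<in> (\<Pi> n\<in>UNIV. {..<h n}). \<exists>\<phi>\<in>\<Phi>. f \<sqsubseteq>\<^sub>s \<phi>)", OF this]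
  show thesis
    unfolding l_prime_def[symmetric] by (elim exE conjE) (rule that)
qed

text \<open>Transfinite recursion of length \<open>add_null\<close>: at every stage fewer than \<open>add_null\<close> slaloms
  have to be bounded.\<close>

lemma ex_increasing_narrow_slaloms:
  assumes \<Psi>: "\<Psi> \<subseteq> narrow_slaloms" "\<Psi> \<noteq> {}" "|\<Psi>| \<le>o add_null"
  shows "\<exists>\<phi>. (\<forall>\<alpha>\<in>Field add_null. \<phi> \<alpha> \<in> narrow_slaloms) \<and>
    (\<forall>\<alpha> \<beta>. (\<alpha>, \<beta>) \<in> add_null \<longrightarrow> (\<forall>\<^sub>\<infinity>n. \<phi> \<alpha> n \<subseteq> \<phi> \<beta> n)) \<and>
    (\<forall>\<psi>\<in>\<Psi>. \<exists>\<alpha>\<in>Field add_null. \<forall>\<^sub>\<infinity>n. \<psi> n \<subseteq> \<phi> \<alpha> n)"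
proof -
  let ?\<kappa> = "add_null"
  have "|\<Psi>| \<le>o |Field ?\<kappa>|"
    using \<Psi>(3) card_of_Field_ordIso[OF Card_order_add_null] ordIso_symmetric ordLeq_ordIso_trans by blast
  \<comment> \<open>\<open>\<Psi>\<close> is enumerated, possibly with repetitions, along the
    well-order \<open>add_null\<close> itself.\<close>
  then have "\<exists>e. e ` Field ?\<kappa> = \<Psi>"
    unfolding card_of_ordLeq2[OF \<Psi>(2)] .
  then obtain e where e: "e ` Field ?\<kappa> = \<Psi>"
    by (elim exE)
  have wo: "Well_order ?\<kappa>"
    using Card_order_add_null by (rule card_order_on_well_order_on)
  then have "wf (?\<kappa> - Id)"
    by (simp add: well_order_on_def)
  then have "\<exists>\<phi>. \<forall>\<alpha>. \<alpha> \<in> Field ?\<kappa> \<longrightarrow> \<phi> \<alpha> \<in> narrow_slaloms \<and>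
      (\<forall>\<beta>. (\<beta>, \<alpha>) \<in> ?\<kappa> - Id \<longrightarrow> (\<forall>\<^sub>\<infinity>n. \<phi> \<beta> n \<subseteq> \<phi> \<alpha> n)) \<and> (\<forall>\<^sub>\<infinity>n. e \<alpha> n \<subseteq> \<phi> \<alpha> n)"
  proof (rule dependent_wf_choice)
    fix \<alpha> \<phi>
    assume IH: "\<And>\<beta>. (\<beta>, \<alpha>) \<in> ?\<kappa> - Id \<Longrightarrow> \<beta> \<in> Field ?\<kappa> \<longrightarrow> \<phi> \<beta> \<in> narrow_slaloms \<and>
      (\<forall>\<gamma>. (\<gamma>, \<beta>) \<in> ?\<kappa> - Id \<longrightarrow> (\<forall>\<^sub>\<infinity>n. \<phi> \<gamma> n \<subseteq> \<phi> \<beta> n)) \<and> (\<forall>\<^sub>\<infinity>n. e \<beta> n \<subseteq> \<phi> \<beta> n)"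
    show "\<exists>\<psi>. \<alpha> \<in> Field ?\<kappa> \<longrightarrow> \<psi> \<in> narrow_slaloms \<and>
      (\<forall>\<beta>. (\<beta>, \<alpha>) \<in> ?\<kappa> - Id \<longrightarrow> (\<forall>\<^sub>\<infinity>n. \<phi> \<beta> n \<subseteq> \<psi> n)) \<and> (\<forall>\<^sub>\<infinity>n. e \<alpha> n \<subseteq> \<psi> n)"
    proof (cases "\<alpha> \<in> Field ?\<kappa>")
      case True
      have "\<phi> ` underS ?\<kappa> \<alpha> \<subseteq> narrow_slaloms"
        using IH unfolding underS_def by (auto dest: FieldI1)
      moreover have "|\<phi> ` underS ?\<kappa> \<alpha>| <o ?\<kappa>"
        using card_of_image card_of_underS[OF Card_order_add_null True] by (rule ordLeq_ordLess_trans)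
      ultimately have "\<exists>\<psi>\<in>narrow_slaloms. \<forall>\<theta>\<in>\<phi> ` underS ?\<kappa> \<alpha>. \<forall>\<^sub>\<infinity>n. \<theta> n \<subseteq> \<psi> n"
        by (rule narrow_slaloms_directed)
      then obtain \<psi> where \<psi>: "\<psi> \<in> narrow_slaloms"
          "\<And>\<beta>. \<beta> \<in> underS ?\<kappa> \<alpha> \<Longrightarrow> \<forall>\<^sub>\<infinity>n. \<phi> \<beta> n \<subseteq> \<psi> n"
        unfolding ball_simps(9) by metis
      \<comment> \<open>Joining \<open>e \<alpha>\<close> to the bound makes the sequence eventually
        contain every member of \<open>\<Psi>\<close>.\<close>
      have "e \<alpha> \<in> narrow_slaloms"
        using e True \<Psi>(1) by blast
      then have "(\<lambda>n. \<psi> n \<union> e \<alpha> n) \<in> narrow_slaloms"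
        by (rule narrow_slaloms_Un[OF \<psi>(1)])
      moreover have "\<forall>\<^sub>\<infinity>n. \<phi> \<beta> n \<subseteq> \<psi> n \<union> e \<alpha> n" if "(\<beta>, \<alpha>) \<in> ?\<kappa> - Id" for \<beta>
        by (rule MOST_mono[OF \<psi>(2)]) (use that in \<open>auto simp: underS_def\<close>)
      ultimately show ?thesis
        by (intro exI[of _ "\<lambda>n. \<psi> n \<union> e \<alpha> n"]) simp
    qed blast
  qed simp
  then obtain \<phi> where \<phi>: "\<And>\<alpha>. \<alpha> \<in> Field ?\<kappa> \<Longrightarrow> \<phi> \<alpha> \<in> narrow_slaloms"
      "\<And>\<alpha> \<beta>. \<alpha> \<in> Field ?\<kappa> \<Longrightarrow> (\<beta>, \<alpha>) \<in> ?\<kappa> - Id \<Longrightarrow> \<forall>\<^sub>\<infinity>n. \<phi> \<beta> n \<subseteq> \<phi> \<alpha> n"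
      "\<And>\<alpha>. \<alpha> \<in> Field ?\<kappa> \<Longrightarrow> \<forall>\<^sub>\<infinity>n. e \<alpha> n \<subseteq> \<phi> \<alpha> n"
    by blast
  have "\<forall>\<^sub>\<infinity>n. \<phi> \<alpha> n \<subseteq> \<phi> \<beta> n" if "(\<alpha>, \<beta>) \<in> ?\<kappa>" for \<alpha> \<beta>
  proof (cases "\<alpha> = \<beta>")
    case False
    then show ?thesis
      using \<phi>(2)[of \<beta> \<alpha>] that by (simp add: FieldI2)
  qed simp
  moreover have "\<exists>\<alpha>\<in>Field ?\<kappa>. \<forall>\<^sub>\<infinity>n. \<psi> n \<subseteq> \<phi> \<alpha> n" if "\<psi> \<in> \<Psi>" for \<psi>
    using that \<phi>(3) unfolding e[symmetric] by blast
  ultimately show ?thesis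
    using \<phi>(1) by blast
qed

text \<open>The metrics come from an increasing sequence of narrow slaloms. Narrowness keeps each
  compactification different from \<beta>\<omega>. The covering makes every indicator a Higson
  function for one of them, and since extending all indicators suffices to extend all bounded
  functions, the supremum is \<beta>\<omega>.\<close>

lemma ex_higson_chain:
  assumes \<Psi>: "\<Psi> \<subseteq> narrow_slaloms" "|\<Psi>| \<le>o add_null"
    and cov: "\<And>A. \<exists>\<psi>\<in>\<Psi>. \<forall>\<^sub>\<infinity>n. set_encode (A \<inter> {..<2 ^ Suc n}) \<in> \<psi> n"
  shows "\<exists>D. higson_chain D \<and> |D| \<le>o add_null"
proof -
  let ?\<kappa> = "add_null"
  have "\<Psi> \<noteq> {}"
    using cov by blast
  then obtain \<phi> where \<phi>: "\<And>\<alpha>. \<alpha> \<in> Field ?\<kappa> \<Longrightarrow> \<phi> \<alpha> \<in> narrow_slaloms"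
      "\<And>\<alpha> \<beta>. (\<alpha>, \<beta>) \<in> ?\<kappa> \<Longrightarrow> \<forall>\<^sub>\<infinity>n. \<phi> \<alpha> n \<subseteq> \<phi> \<beta> n"
      "\<And>\<psi>. \<psi> \<in> \<Psi> \<Longrightarrow> \<exists>\<alpha>\<in>Field ?\<kappa>. \<forall>\<^sub>\<infinity>n. \<psi> n \<subseteq> \<phi> \<alpha> n"
    using ex_increasing_narrow_slaloms[OF \<Psi>(1) _ \<Psi>(2)] by blast
  define d where "d \<alpha> = slalom_metric (\<phi> \<alpha>)" for \<alpha>
  define D where "D = d ` Field ?\<kappa>"
  have capt: "\<exists>d\<in>D. higson_function d (indicat_real A)" for A
  proof -
    obtain \<psi> where \<psi>: "\<psi> \<in> \<Psi>" "\<forall>\<^sub>\<infinity>n. set_encode (A \<inter> {..<2 ^ Suc n}) \<in> \<psi> n"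
      using cov by blast
    obtain \<alpha> where \<alpha>: "\<alpha> \<in> Field ?\<kappa>" "\<forall>\<^sub>\<infinity>n. \<psi> n \<subseteq> \<phi> \<alpha> n"
      using \<phi>(3)[OF \<psi>(1)] by blast
    have "higson_function (d \<alpha>) (indicat_real A)"
      unfolding d_def using higson_function_slalom_metric_indicator[OF \<psi>(2)] \<alpha>(2)
      by (rule higson_function_slalom_metric_mono[rotated])
    then show ?thesis
      using \<alpha>(1) by (auto simp: D_def)
  qed
  have "higson_chain D"
    unfolding higson_chain_def
  proof (intro conjI)
    show "\<forall>d\<in>D. proper_metric d"
      by (simp add: D_def d_def proper_metric_slalom_metric)
    have "higson (d \<alpha>) \<preceq> higson (d \<beta>)" if "(\<alpha>, \<beta>) \<in> ?\<kappa>" for \<alpha> \<beta>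
      unfolding higson_le_higson_iff d_def
      using higson_function_slalom_metric_mono[OF \<phi>(2)[OF that]] by blast
    then show "well_order_on (higson ` D) {(a, b). a \<in> higson ` D \<and> b \<in> higson ` D \<and> a \<preceq> b}"
      unfolding D_def using card_order_on_well_order_on[OF Card_order_add_null]
      by (intro well_order_on_higson_image)
    show "\<not> (\<exists>d\<in>D. higson d \<simeq> beta_omega)"
    proof
      assume "\<exists>d\<in>D. higson d \<simeq> beta_omega"
      then obtain \<alpha> where \<alpha>: "\<alpha> \<in> Field ?\<kappa>" "beta_omega \<preceq> higson (d \<alpha>)"
        by (auto simp: D_def cpt_equiv_def)
      then have higson: "higson_function (d \<alpha>) f" if "bounded (range f)" for f
        using that by (simp add: beta_omega_le_iff[OF higson_is_compactification] extends_to_higson_iff)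
      show False
        using ex_not_higson_function_slalom_metric[OF \<phi>(1)[OF \<alpha>(1)]] higson[OF bounded_indicator]
        by (simp add: d_def)
    qed
    show "\<exists>s. is_cpt_sup (higson ` D) s \<and> beta_omega \<simeq> s"
    proof (intro exI[of _ beta_omega] conjI)
      show "is_cpt_sup (higson ` D) beta_omega"
        unfolding is_cpt_sup_def
      proof (intro conjI allI impI)
        show "\<forall>c\<in>higson ` D. c \<preceq> beta_omega"
          by (simp add: higson_le_beta_omega)
        fix t :: "((nat \<Rightarrow> real) \<Rightarrow> real) cpt"
        assume t: "is_compactification t \<and> (\<forall>c\<in>higson ` D. c \<preceq> t)"
        have "extends_to (indicat_real A) t" for A
        proof -
          obtain d' where "d' \<in> D" "higson_function d' (indicat_real A)"
            using capt by blast
          then show ?thesis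
            using t extends_to_mono[of _ "higson d'" t] by (simp add: extends_to_higson_iff)
        qed
        then show "beta_omega \<preceq> t"
          using t beta_omega_le_iff extends_to_of_indicators by blast
      qed (rule beta_omega_is_compactification)
    qed (simp add: cpt_equiv_def cpt_le_refl)
  qed
  moreover have "|D| \<le>o ?\<kappa>"
    unfolding D_def using card_of_image card_of_Field_ordIso[OF Card_order_add_null] by (rule ordLeq_ordIso_trans)
  ultimately show ?thesis by blast
qed

theorem theorem3p2:
  assumes "add_null =o l_prime H2"
  shows "ht =o add_null"
proof -
  obtain \<Phi> where \<Phi>: "\<Phi> \<subseteq> slaloms_plus" "\<forall>f \<in> (\<Pi> n\<in>UNIV. {..<H2 n}). \<exists>\<phi>\<in>\<Phi>. f \<sqsubseteq>\<^sub>s \<phi>"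
    "l_prime H2 = |\<Phi>|"
    by (rule l_prime_properties)
  have \<Phi>_eq: "|\<Phi>| =o add_null"
    using assms unfolding \<Phi>(3) by (rule ordIso_symmetric)
  have "|Field add_null| =o |\<Phi>|"
    using card_of_Field_ordIso[OF Card_order_add_null] assms unfolding \<Phi>(3) by (rule ordIso_transitive)
  then have "infinite \<Phi>"
    using infinite_Field_add_null card_of_ordIso_finite by blast
  \<comment> \<open>Narrowing uses pairs from \<open>\<Phi>\<close>; as \<open>\<Phi>\<close> is
    infinite, the cardinality does not grow.\<close>
  then have sq: "|\<Phi> \<times> \<Phi>| =o add_null"
    using ordIso_transitive[OF card_of_Times_same_infinite \<Phi>_eq] by blast
  have "\<Phi> \<subseteq> slaloms"
    using \<Phi>(1) by (auto simp: slaloms_plus_def)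
  from ex_narrow_cover[OF this \<Phi>(2)]
  obtain \<Psi> where \<Psi>: "\<Psi> \<subseteq> narrow_slaloms" "|\<Psi>| \<le>o |\<Phi> \<times> \<Phi>|"
      "\<forall>A. \<exists>\<psi>\<in>\<Psi>. \<forall>\<^sub>\<infinity>n. set_encode (A \<inter> {..<2 ^ Suc n}) \<in> \<psi> n"
    by blast
  obtain D where D: "higson_chain D" "|D| \<le>o add_null"
    using ex_higson_chain[OF \<Psi>(1) ordLeq_ordIso_trans[OF \<Psi>(2) sq]] \<Psi>(3) by blast
  obtain D0 where D0: "higson_chain D0" "min_card higson_chain = |D0|"
      "\<And>B. higson_chain B \<Longrightarrow> |D0| \<le>o |B|"
    using min_card_properties[of higson_chain, OF D(1)] by blast
  \<comment> \<open>A chain exists, so the first case of \<open>ht\<close> applies; adding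
    \<open>czero\<close> preserves the cardinality.\<close>
  have "ht = |D0| +c (czero :: real set rel)"
    using D(1) unfolding ht_def D0(2)[symmetric] by auto
  also have "\<dots> =o |D0|"
    unfolding csum_def czero_def Field_card_of by (rule ordIso_symmetric[OF card_of_Plus_empty1])
  finally have "ht =o |D0|" .
  moreover have "|D0| =o add_null"
    unfolding ordIso_iff_ordLeq
    using ordLeq_transitive[OF D0(3)[OF D(1)] D(2)] add_null_le_higson_chain[OF D0(1)] by (rule conjI)
  ultimately show ?thesis
    by (rule ordIso_transitive)
qed

end
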